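(* Let $s\ge0$ be an even integer, let $\Theta_1,\dots,\Theta_n$ be i.i.d. circular random variables with density $f$, let $(L_\rho)$ be a circular kernel family, let $(\rho_n)$ be a (non-random) sequence of smoothing parameters, and let $$\hat\psi_{s;\rho}=\frac1{n^2}\sum_{i=1}^n\sum_{j=1}^nL_\rho^{(s)}(\Theta_i-\Theta_j)$$ be the estimator of $\psi_s=\int_{-\pi}^{\pi}f^{(s)}(\theta)f(\theta)\,d\theta$. Assume: (A1) $f^{(s+2)}$ is continuous and square-integrable on $[-\pi,\pi)$. (A2) $L$ is a bounded circular density, reflectively symmetric about zero, unimodal, and its $s$-th derivative is square-integrable on $[-\pi,\pi)$. (A3) As $n\to\infty$: $h_L(\rho_n)\to0$, $R_{L;s,2}(\rho_n)\to\infty$ and $n^{-1}R_{L;s,2}(\rho_n)\to0$. (A4) As $n\to\infty$: $|R_{L;s,1}(\rho_n)|\to\infty$ and $n^{-1}R_{L;s,1}(\rho_n)\to0$. (E1) $\int_{-\pi}^{\pi}\theta^4L_{\rho_n}(\theta)\,d\theta=o\big(h_L(\rho_n)\big)$. (E2) $\int_{-\pi}^{\pi}\theta^2\big(L^{(s)}_{\rho_n}(\theta)\big)^2d\theta=o\big(R_{L;s,2}(\rho_n)\big)$. Then $$\mathrm{AMSE}\big[\hat\psi_{s;\rho_n}\big]=\Big(n^{-1}R_{L;s,1}(\rho_n)+\tfrac12h_L(\rho_n)\psi_{s+2}\Big)^2+2n^{-2}\psi_0R_{L;s,2}(\rho_n)+4n^{-1}\left(\int_{-\pi}^{\pi}\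big(f^{(s)}(\theta)\big)^2f(\theta)\,d\theta-\psi_s^2\right).$$
   Context: Circular densities are regarded as $2\pi$-periodic functions on the real line (so continuity and derivatives are understood on the circle) that integrate to one over $[-\pi,\pi)$. For every even $k\ge0$ used, $\psi_k=\int_{-\pi}^{\pi}f^{(k)}(\theta)f(\theta)\,d\theta$. A circular kernel family $L_\rho$ is a family of circular densities, symmetric about zero, unimodal and square-integrable, indexed by the smoothing parameter $\rho\in[0,1]$ (the mean resultant length), with convergent Fourier series $$L_\rho(\theta)=\frac1{2\pi}\Big(1+2\sum_{j=1}^\infty\alpha_{L,j}(\rho)\cos(j\theta)\Big),\qquad \alpha_{L,j}(\rho)\in[0,1].$$ Define $h_L(\rho)=\frac{\pi^2}{3}+4\sum_{j=1}^\infty\frac{(-1)^j\alpha_{L,j}(\rho)}{j^2}$ and, for $t\in\{1,2\}$ and even $s$, $$R_{L;0,t}(\rho)=\frac1{2\pi}\Big(1+2\sum_{j=1}^\infty\alpha_{L,j}^t(\rho)\Big),\qquad R_{L;s,t}(\rho)=\frac{\mathfrak s}{\pi}\sum_{j=1}^\infty j^{ts}\alpha_{L,j}^t(\rho)\quad(s\ge2),$$ where $\mathfrak s=-1$ if $t=1$ and $s\equiv2\pmod 4$, and $\mathfrak s=1$ otherwise. $\mathrm{AMSE}$ is the asymptotic leading part of $\mathbb E[(\hat\psi_{s;\rho_n}-\psi_s)^2]$, namely the square of the leading part of the bias plus the leading part of the variance. Thus the conclusion means: the bias $\mathbb E[\hat\psi_{s;\rho_n}]-\psi_s$ equals $n^{-1}R_{L;s,1}(\rho_n)+\frac12h_L(\rho_n)\psi_{s+2}$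 up to $o(n^{-1}R_{L;s,1}(\rho_n))+o(h_L(\rho_n))$, and the variance of $\hat\psi_{s;\rho_n}$ equals $2n^{-2}\psi_0R_{L;s,2}(\rho_n)+4n^{-1}\big(\int(f^{(s)})^2f-\psi_s^2\big)$ up to $o(n^{-2}R_{L;s,2}(\rho_n))+o(n^{-1})$. *)

theory Defs
  imports "HOL-Probability.Probability" "HOL-Library.Landau_Symbols"
begin

(* The circle is represented by 2 pi-periodic functions on the real line, so that continuity and
   derivatives on the circle are the usual ones on the line. Integrals over the circle are
   Lebesgue integrals over {-pi..<pi}. *)

definition periodic_2pi :: "(real \<Rightarrow> real) \<Rightarrow> bool" where
  "periodic_2pi g \<longleftrightarrow> (\<forall>x. g (x + 2 * pi) = g x)"

definition circular_density :: "(real \<Rightarrow> real) \<Rightarrow> bool" where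
  "circular_density g \<longleftrightarrow>
     periodic_2pi g \<and> g \<in> borel_measurable borel \<and> (\<forall>x. 0 \<le> g x) \<and>
     set_integrable lborel {-pi..<pi} g \<and> (LINT x:{-pi..<pi}|lborel. g x) = 1"

definition circ_square_integrable :: "(real \<Rightarrow> real) \<Rightarrow> bool" where
  "circ_square_integrable g \<longleftrightarrow>
     g \<in> borel_measurable borel \<and> set_integrable lborel {-pi..<pi} (\<lambda>x. (g x)\<^sup>2)"

definition symmetric_about_zero :: "(real \<Rightarrow> real) \<Rightarrow> bool" where
  "symmetric_about_zero g \<longleftrightarrow> (\<forall>x. g (- x) = g x)"

(* Travelling once around the circle from an antimode a, the function increases up to a mode m
   and then decreases; monotonicity is not strict, so the uniform density is included. *)
definition circ_unimodal :: "(real \<Rightarrow> real) \<Rightarrow> bool" where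
  "circ_unimodal g \<longleftrightarrow>
     (\<exists>a m. a \<le> m \<and> m \<le> a + 2 * pi \<and> mono_on {a..m} g \<and> antimono_on {m..a + 2 * pi} g)"

definition mean_resultant_length :: "(real \<Rightarrow> real) \<Rightarrow> real" where
  "mean_resultant_length g = cmod (LINT x:{-pi..<pi}|lborel. complex_of_real (g x) * cis x)"

definition times_differentiable :: "nat \<Rightarrow> (real \<Rightarrow> real) \<Rightarrow> bool" where
  "times_differentiable k g \<longleftrightarrow> (\<forall>i<k. \<forall>x. (deriv ^^ i) g differentiable (at x))"

definition psi :: "(real \<Rightarrow> real) \<Rightarrow> nat \<Rightarrow> real" where
  "psi f k = (LINT x:{-pi..<pi}|lborel. (deriv ^^ k) f x * f x)"

definition kernel_coeff :: "(real \<Rightarrow> real \<Rightarrow> real) \<Rightarrow> nat \<Rightarrow> real \<Rightarrow> real" where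
  "kernel_coeff L j \<rho> = (LINT x:{-pi..<pi}|lborel. L \<rho> x * cos (real j * x))"

(* The Fourier series is required to converge pointwise to the kernel. The value \<rho> = 1 is left
   unconstrained: it is the degenerate point-mass limit, as no circular density has mean
   resultant length 1. *)
definition circular_kernel_family :: "(real \<Rightarrow> real \<Rightarrow> real) \<Rightarrow> bool" where
  "circular_kernel_family L \<longleftrightarrow>
     (\<forall>\<rho>\<in>{0..<1}.
        circular_density (L \<rho>) \<and> symmetric_about_zero (L \<rho>) \<and> circ_unimodal (L \<rho>) \<and>
        circ_square_integrable (L \<rho>) \<and> mean_resultant_length (L \<rho>) = \<rho> \<and>
        (\<forall>j\<ge>1. kernel_coeff L j \<rho> \<in> {0..1}) \<and>
        (\<forall>x. summable (\<lambda>j. kernel_coeff L (Suc j) \<rho> * cos (real (Suc j) * x)) \<and>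
             L \<rho> x = 1 / (2 * pi) *
               (1 + 2 * (\<Sum>j. kernel_coeff L (Suc j) \<rho> * cos (real (Suc j) * x)))))"

definition h_kernel :: "(real \<Rightarrow> real \<Rightarrow> real) \<Rightarrow> real \<Rightarrow> real" where
  "h_kernel L \<rho> =
     pi\<^sup>2 / 3 + 4 * (\<Sum>j. (-1) ^ Suc j * kernel_coeff L (Suc j) \<rho> / (real (Suc j))\<^sup>2)"

definition R_kernel :: "(real \<Rightarrow> real \<Rightarrow> real) \<Rightarrow> nat \<Rightarrow> nat \<Rightarrow> real \<Rightarrow> real" where
  "R_kernel L s t \<rho> =
     (if s = 0 then 1 / (2 * pi) * (1 + 2 * (\<Sum>j. kernel_coeff L (Suc j) \<rho> ^ t))
      else (if t = 1 \<and> s mod 4 = 2 then -1 else 1) / pi *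
        (\<Sum>j. real (Suc j) ^ (t * s) * kernel_coeff L (Suc j) \<rho> ^ t))"

definition psi_hat ::
  "(real \<Rightarrow> real \<Rightarrow> real) \<Rightarrow> nat \<Rightarrow> real \<Rightarrow> (nat \<Rightarrow> 'a \<Rightarrow> real) \<Rightarrow> nat \<Rightarrow> 'a \<Rightarrow> real" where
  "psi_hat L s \<rho> \<Theta> n \<omega> =
     1 / (real n)\<^sup>2 * (\<Sum>i=1..n. \<Sum>j=1..n. (deriv ^^ s) (L \<rho>) (\<Theta> i \<omega> - \<Theta> j \<omega>))"

(* The remainder class o(u) + o(v). *)
definition smallo_sum :: "(nat \<Rightarrow> real) \<Rightarrow> (nat \<Rightarrow> real) \<Rightarrow> (nat \<Rightarrow> real) set" where
  "smallo_sum u v = {r. \<exists>p\<in>o(u). \<exists>q\<in>o(v). \<forall>n. r n = p n + q n}"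

(* A is the asymptotic mean squared error of the estimators T of c: b is the leading part of the
   bias up to remainders in B, v is the leading part of the variance up to remainders in V, and
   A is the square of b plus v. Square-integrability is part of the notion, since the Bochner
   integral of a non-integrable function is 0 by convention. *)
definition has_AMSE ::
  "'a measure \<Rightarrow> (nat \<Rightarrow> 'a \<Rightarrow> real) \<Rightarrow> real \<Rightarrow>
   (nat \<Rightarrow> real) \<Rightarrow> (nat \<Rightarrow> real) set \<Rightarrow> (nat \<Rightarrow> real) \<Rightarrow> (nat \<Rightarrow> real) set \<Rightarrow> (nat \<Rightarrow> real) \<Rightarrow> bool" where
  "has_AMSE M T c b B v V A \<longleftrightarrow>
     (\<forall>n. T n \<in> borel_measurable M \<and> integrable M (\<lambda>\<omega>. (T n \<omega> - c)\<^sup>2)) \<and>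
     (\<lambda>n. (prob_space.expectation M (T n) - c) - b n) \<in> B \<and>
     (\<lambda>n. prob_space.variance M (T n) - v n) \<in> V \<and>
     (\<forall>n. A n = (b n)\<^sup>2 + v n)"

end

theory Submission
  imports Defs
begin

text \<open>
  Write \<open>K\<close> for the kernel, \<open>G = K\<^sup>(\<^sup>s\<^sup>)\<close> and \<open>h = \<integral>x\<^sup>2 K\<close>. Because the Fourier coefficients of \<open>K\<close> are nonnegative and \<open>K\<close> is
  \<open>s\<close> times differentiable, \<open>G\<close> is an absolutely convergent cosine series; this identifies \<open>R\<^bsub>s,1\<^esub> = G 0\<close>,
  \<open>R\<^bsub>s,2\<^esub> = \<integral>G\<^sup>2\<close> and \<open>h\<^sub>L = h\<close>. Integration by parts moves the \<open>s\<close> derivatives to the density, and a Taylor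
  expansion gives \<open>\<integral>G (y - x) f x dx = f\<^sup>(\<^sup>s\<^sup>) y + h f\<^sup>(\<^sup>s\<^sup>+\<^sup>2\<^sup>) y / 2 + o(h)\<close> uniformly in \<open>y\<close>, where the modulus of continuity
  \<open>\<epsilon> + C u\<^sup>2\<close> reduces the remainder to the fourth moment in (E1); (E2) plays the same role for
  \<open>\<integral>G\<^sup>2 (y - x) f x dx = f y R\<^bsub>s,2\<^esub> + o(R\<^bsub>s,2\<^esub>)\<close>. Hoeffding's decomposition of the double sum expresses the variance
  exactly in terms of these averages.
\<close>

section \<open>Integration over a period\<close>

text \<open>Differentiability of order \<open>s\<close> gives neither continuity of \<open>G\<close>
  nor the right to differentiate the Fourier series term by term. Nonnegative coefficients supply
  both: as for characteristic functions, a second derivative at the single point 0 already bounds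
  the second moment of the coefficients, and this dominates the differentiated series everywhere.
  The smoothing parameter does not rescale a fixed kernel, so no change of variables concentrates
  the mass at 0. Concentration enters through moments only, and error bounds must hold for all
  \<open>u\<close> in the period, not merely for small \<open>u\<close>. Terms with equal indices
  are the constant \<open>G 0\<close>. The other \<open>n (n - 1)\<close> terms have a common mean
  \<open>e\<close>, so the bias carries an extra \<open>- e / n\<close>, which is negligible because
  \<open>e\<close> converges while \<open>\<bar>R_{s,1}\<bar>\<close> diverges. In the variance the
  degenerate part has order \<open>R_{s,2} / n^2\<close>, and bounded corrections vanish against
  \<open>R_{s,2}\<close>; the projection part contributes the variance of \<open>f^(s)\<close> at a
  sample point, with the factor \<open>4 / n\<close>.\<close>

abbreviation (input) cint :: "(real \<Rightarrow> real) \<Rightarrow> real" where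
  "cint \<phi> \<equiv> (LINT x:{-pi..<pi}|lborel. \<phi> x)"

lemma cint_integrable:
  assumes "continuous_on UNIV \<phi>"
  shows "set_integrable lborel {-pi..<pi} (\<phi> :: real \<Rightarrow> real)"
proof (rule set_integrable_subset)
  show "set_integrable lborel {-pi..pi} \<phi>"
    by (intro borel_integrable_atLeastAtMost' continuous_on_subset[OF assms]) auto
qed auto

lemma cint_FTC:
  assumes "\<And>x. (F has_real_derivative \<phi> x) (at x)" "continuous_on UNIV \<phi>"
  shows "cint \<phi> = F pi - F (- pi)"
proof -
  have "cint \<phi> = (LBINT x=ereal (-pi)..ereal pi. \<phi> x)"
    by (subst interval_integral_Ico) auto
  also have "\<dots> = F pi - F (- pi)"
    by (rule interval_integral_FTC_finite)
       (auto intro: continuous_on_subset[OF assms(2)] has_field_derivative_at_within[OF assms(1)]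
         simp: has_real_derivative_iff_has_vector_derivative[symmetric])
  finally show ?thesis .
qed

text \<open>With a global antiderivative, reflection and translation of the variable reduce to
  \<open>cint_FTC\<close>.\<close>

lemma continuous_antiderivative:
  assumes "continuous_on UNIV (\<phi> :: real \<Rightarrow> real)"
  obtains P where "\<And>x. (P has_real_derivative \<phi> x) (at x)"
proof -
  have "\<exists>F. \<forall>x :: real. -\<infinity> < ereal x \<longrightarrow> ereal x < \<infinity> \<longrightarrow> (F has_vector_derivative \<phi> x) (at x)"
    by (rule einterval_antiderivative) (use assms in \<open>auto simp: continuous_on_eq_continuous_at\<close>)
  then show ?thesis
    using that by (auto simp: has_real_derivative_iff_has_vector_derivative)
qed

lemma cint_add:
  "continuous_on UNIV \<phi> \<Longrightarrow> continuous_on UNIV \<gamma> \<Longrightarrow>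
    cint (\<lambda>x. \<phi> x + \<gamma> x) = cint \<phi> + cint \<gamma>"
  by (intro set_integral_add cint_integrable)

lemma cint_mono:
  "continuous_on UNIV \<phi> \<Longrightarrow> continuous_on UNIV \<gamma> \<Longrightarrow> (\<And>x. x \<in> {-pi..<pi} \<Longrightarrow> \<phi> x \<le> \<gamma> x) \<Longrightarrow>
    cint \<phi> \<le> cint \<gamma>"
  by (intro set_integral_mono cint_integrable)

lemma cint_nonneg:
  "(\<And>x. 0 \<le> \<phi> x) \<Longrightarrow> 0 \<le> cint \<phi>"
  unfolding set_lebesgue_integral_def by (intro Bochner_Integration.integral_nonneg) auto

lemma cint_abs_diff_le:
  assumes "continuous_on UNIV \<phi>" "continuous_on UNIV \<gamma>" "continuous_on UNIV \<omega>"
    and "\<And>x. x \<in> {-pi..<pi} \<Longrightarrow> \<bar>\<phi> x - \<gamma> x\<bar> \<le> \<omega> x"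
  shows "\<bar>cint \<phi> - cint \<gamma>\<bar> \<le> cint \<omega>"
proof -
  have "cint (\<lambda>x. \<gamma> x - \<omega> x) \<le> cint \<phi>" "cint \<phi> \<le> cint (\<lambda>x. \<gamma> x + \<omega> x)"
    using assms(4) by (intro cint_mono continuous_intros assms; force simp: abs_le_iff)+
  moreover have "cint (\<lambda>x. \<gamma> x - \<omega> x) = cint \<gamma> - cint \<omega>"
    by (intro set_integral_diff cint_integrable assms)
  ultimately show ?thesis
    using cint_add[OF assms(2,3)] by auto
qed

lemma cint_const: "cint (\<lambda>x. c) = 2 * pi * c"
  using cint_FTC[of "\<lambda>x. c * x" "\<lambda>x. c"] by (auto intro!: derivative_eq_intros)

lemma cint_uminus_arg:
  assumes "continuous_on UNIV \<phi>"
  shows "cint (\<lambda>x. \<phi> (- x)) = cint \<phi>"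
proof -
  obtain P where P: "\<And>x. (P has_real_derivative \<phi> x) (at x)"
    using continuous_antiderivative[OF assms] by blast
  have "cint (\<lambda>x. \<phi> (- x)) = (- P (- pi)) - (- P (- (- pi)))"
    by (rule cint_FTC) (auto intro!: derivative_eq_intros DERIV_chain2[OF P]
        continuous_on_compose2[OF assms] continuous_intros)
  then show ?thesis
    using cint_FTC[OF P assms] by simp
qed

lemma cint_translate:
  assumes c: "continuous_on UNIV \<phi>" and p: "periodic_2pi \<phi>"
  shows "cint (\<lambda>x. \<phi> (x - y)) = cint \<phi>"
proof -
  obtain P where P: "\<And>x. (P has_real_derivative \<phi> x) (at x)"
    using continuous_antiderivative[OF c] by blast
  \<comment> \<open>The gain of the antiderivative over a window of length 2 pi has derivative
    \<open>\<phi> (x + 2 * pi) - \<phi> x = 0\<close>, so every window of one period carries the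
    same integral.\<close>
  have "((\<lambda>x. P (x + 2 * pi) - P x) has_real_derivative 0) (at x)" for x
    using p[unfolded periodic_2pi_def]
    by (auto intro!: derivative_eq_intros DERIV_chain2[OF P] P)
  then have const: "P (x + 2 * pi) - P x = P (z + 2 * pi) - P z" for x z
    by (meson DERIV_isconst_all)
  have "cint (\<lambda>x. \<phi> (x - y)) = P (pi - y) - P (- pi - y)"
    by (rule cint_FTC) (use P DERIV_shift[of P _ _ "- y"] in
        \<open>auto intro!: continuous_on_compose2[OF c] continuous_intros\<close>)
  then show ?thesis
    using cint_FTC[OF P c] const[of "-pi - y" "-pi"] by (simp add: algebra_simps)
qed

section \<open>Integration by parts for periodic functions\<close>

lemma cint_by_parts:
  assumes p: "periodic_2pi p" and q: "periodic_2pi q"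
    and p': "\<And>x. (p has_real_derivative p' x) (at x)" and q': "\<And>x. (q has_real_derivative q' x) (at x)"
    and c: "continuous_on UNIV p'" "continuous_on UNIV q'"
  shows "cint (\<lambda>x. p' x * q x) = - cint (\<lambda>x. p x * q' x)"
proof -
  have cpq: "continuous_on UNIV p" "continuous_on UNIV q"
    using p' q' by (auto simp: continuous_on_eq_continuous_at intro: DERIV_isCont)
  have "cint (\<lambda>x. p' x * q x + p x * q' x) = p pi * q pi - p (- pi) * q (- pi)"
    by (rule cint_FTC) (auto intro!: derivative_eq_intros p' q' continuous_intros cpq c)
  also have "\<dots> = 0"
    using p[unfolded periodic_2pi_def, rule_format, of "-pi"]
      q[unfolded periodic_2pi_def, rule_format, of "-pi"] by simp
  finally show ?thesis
    by (subst (asm) cint_add) (auto intro!: continuous_intros cpq c)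
qed

lemma periodic_2pi_deriv:
  assumes "periodic_2pi g" "\<And>x. g differentiable (at x)"
  shows "periodic_2pi (deriv g)"
  unfolding periodic_2pi_def
proof
  fix x
  have "(g has_real_derivative deriv g (x + 2 * pi)) (at (x + 2 * pi))"
    using assms(2) by (simp add: DERIV_deriv_iff_real_differentiable)
  then have "((\<lambda>x. g (x + 2 * pi)) has_real_derivative deriv g (x + 2 * pi) * 1) (at x)"
    by (intro DERIV_chain2[where g = "\<lambda>x. x + 2 * pi"]) (auto intro!: derivative_eq_intros)
  moreover have "(\<lambda>x. g (x + 2 * pi)) = g"
    using assms(1) by (auto simp: periodic_2pi_def)
  ultimately show "deriv g (x + 2 * pi) = deriv g x"
    by (metis DERIV_imp_deriv mult.right_neutral)
qed

lemma times_differentiableD: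
  assumes "times_differentiable k g" "i < k"
  shows "((deriv ^^ i) g has_real_derivative (deriv ^^ Suc i) g x) (at x)"
  using assms unfolding times_differentiable_def by (simp add: DERIV_deriv_iff_real_differentiable)

lemma times_differentiable_continuous:
  assumes "times_differentiable k g" "i < k"
  shows "continuous_on UNIV ((deriv ^^ i) g)"
  using times_differentiableD[OF assms] by (auto simp: continuous_on_eq_continuous_at intro: DERIV_isCont)

lemma times_differentiable_periodic:
  assumes "times_differentiable k g" "periodic_2pi g" "i \<le> k"
  shows "periodic_2pi ((deriv ^^ i) g)"
  using assms(3)
proof (induction i)
  case (Suc i)
  then show ?case
    using assms(1) periodic_2pi_deriv[of "(deriv ^^ i) g"]
    by (auto simp: times_differentiable_def)
qed (use assms in auto)

text \<open>Each derivative moved from \<open>K\<close> to \<open>f\<close> costs a sign; the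
  boundary terms cancel by periodicity. At \<open>k = s\<close> with \<open>s\<close> even the signs
  cancel, and an integral against the oscillating \<open>(deriv ^^ s) K\<close> has become one
  against \<open>K\<close> itself, to which positivity and moment arguments apply.\<close>

lemma cint_derivs_shift:
  assumes K: "times_differentiable s K" "continuous_on UNIV ((deriv ^^ s) K)" "periodic_2pi K"
    and f: "times_differentiable s f" "continuous_on UNIV ((deriv ^^ s) f)" "periodic_2pi f"
    and k: "k \<le> s"
  shows "cint (\<lambda>u. (deriv ^^ s) K u * f (y + u)) =
         (- 1) ^ k * cint (\<lambda>u. (deriv ^^ (s - k)) K u * (deriv ^^ k) f (y + u))"
  using k
proof (induction k)
  case (Suc k)
  define m where "m = s - Suc k"
  have m: "s - k = Suc m" "m < s" "k < s" using Suc by (auto simp: m_def)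
  \<comment> \<open>\<open>times_differentiable s\<close> makes only the derivatives below order
    \<open>s\<close> continuous; order \<open>s\<close> is covered by the separate continuity
    hypotheses, hence the case split.\<close>
  have cK: "continuous_on UNIV ((deriv ^^ i) K)" and cf: "continuous_on UNIV ((deriv ^^ i) f)"
    if "i \<le> s" for i
    using that times_differentiable_continuous[OF K(1)] K(2) times_differentiable_continuous[OF f(1)] f(2)
    by (cases "i = s"; simp)+
  have "cint (\<lambda>u. (deriv ^^ Suc m) K u * (deriv ^^ k) f (y + u)) =
      - cint (\<lambda>u. (deriv ^^ m) K u * (deriv ^^ Suc k) f (y + u))"
  proof (rule cint_by_parts)
    show "periodic_2pi ((deriv ^^ m) K)"
      by (rule times_differentiable_periodic[OF K(1,3)]) (use m in auto)
    show "periodic_2pi (\<lambda>u. (deriv ^^ k) f (y + u))"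
      using times_differentiable_periodic[OF f(1,3), of k] m
      by (auto simp: periodic_2pi_def add.assoc[symmetric])
    show "((deriv ^^ m) K has_real_derivative (deriv ^^ Suc m) K x) (at x)" for x
      by (rule times_differentiableD[OF K(1)]) (use m in auto)
    show "((\<lambda>u. (deriv ^^ k) f (y + u)) has_real_derivative (deriv ^^ Suc k) f (y + x)) (at x)" for x
      using times_differentiableD[OF f(1) m(3), of "x + y"]
      by (subst (asm) DERIV_shift) (simp add: add.commute)
    show "continuous_on UNIV ((deriv ^^ Suc m) K)" using m by (intro cK) auto
    show "continuous_on UNIV (\<lambda>u. (deriv ^^ Suc k) f (y + u))"
      using m by (intro continuous_on_compose2[OF cf[of "Suc k"]] continuous_intros) auto
  qed
  then show ?case using Suc by (simp add: m(1) m_def[symmetric] del: funpow.simps)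
qed simp

section \<open>Bounds and moduli of continuity of periodic functions\<close>

lemma continuous_periodic_bounded:
  assumes "continuous_on UNIV \<phi>" "periodic_2pi (\<phi> :: real \<Rightarrow> real)"
  obtains B where "B > 0" "\<And>x. \<bar>\<phi> x\<bar> \<le> B"
proof -
  interpret p: periodic_fun_simple \<phi> "2 * pi"
    by unfold_locales (use assms in \<open>auto simp: periodic_2pi_def\<close>)
  have "compact (\<phi> ` {0..2 * pi})"
    by (intro compact_continuous_image continuous_on_subset[OF assms(1)]) auto
  then obtain B where B: "B > 0" "\<And>x. x \<in> {0..2 * pi} \<Longrightarrow> \<bar>\<phi> x\<bar> \<le> B"
    by (metis (no_types) bounded_pos compact_imp_bounded imageI real_norm_def)
  have "\<bar>\<phi> x\<bar> \<le> B" for x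
  proof -
    define k where "k = \<lfloor>x / (2 * pi)\<rfloor>"
    have "of_int k \<le> x / (2 * pi)" "x / (2 * pi) < of_int k + 1"
      unfolding k_def by linarith+
    then have "x - of_int k * (2 * pi) \<in> {0..2 * pi}"
      by (auto simp: field_simps)
    then show ?thesis using B(2) p.minus_of_int[of x k] by metis
  qed
  with B(1) show ?thesis using that by blast
qed

text \<open>For \<open>\<bar>u\<bar> < d\<close> uniform continuity gives \<open>\<epsilon>\<close>.
  Beyond that the oscillation is at most \<open>2 * B\<close> while
  \<open>1 \<le> u\<^sup>2 / d\<^sup>2\<close>, whence \<open>C = 2 * B / d\<^sup>2\<close>.\<close>

lemma periodic_modulus:
  assumes "continuous_on UNIV \<phi>" "periodic_2pi (\<phi> :: real \<Rightarrow> real)" "\<epsilon> > 0"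
  obtains C where "C \<ge> 0" "\<And>x u. \<bar>\<phi> (x + u) - \<phi> x\<bar> \<le> \<epsilon> + C * u\<^sup>2"
proof -
  interpret p: periodic_fun_simple \<phi> "2 * pi"
    by unfold_locales (use assms in \<open>auto simp: periodic_2pi_def\<close>)
  obtain B where B: "B > 0" "\<And>x. \<bar>\<phi> x\<bar> \<le> B"
    using continuous_periodic_bounded assms by blast
  \<comment> \<open>One unit of room at each end keeps \<open>z + u\<close> in the compact interval
    when \<open>z\<close> lies in the base period and
    \<open>\<bar>u\<bar> < d \<le> 1\<close>.\<close>
  have "uniformly_continuous_on {-1..2 * pi + 1} \<phi>"
    by (intro compact_uniformly_continuous continuous_on_subset[OF assms(1)]) auto
  then obtain \<delta> where \<delta>: "\<delta> > 0"
    "\<And>x y. x \<in> {-1..2 * pi + 1} \<Longrightarrow> y \<in> {-1..2 * pi + 1} \<Longrightarrow> \<bar>y - x\<bar> < \<delta> \<Longrightarrow> \<bar>\<phi> y - \<phi> x\<bar> < \<epsilon>"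
    using \<open>\<epsilon> > 0\<close> unfolding uniformly_continuous_on_def dist_real_def by meson
  define d where "d = min \<delta> 1"
  have "\<bar>\<phi> (x + u) - \<phi> x\<bar> \<le> \<epsilon> + (2 * B / d\<^sup>2) * u\<^sup>2" for x u
  proof (cases "\<bar>u\<bar> < d")
    case True
    define k where "k = \<lfloor>x / (2 * pi)\<rfloor>"
    define z where "z = x - of_int k * (2 * pi)"
    have "of_int k \<le> x / (2 * pi)" "x / (2 * pi) < of_int k + 1"
      unfolding k_def by linarith+
    then have "z \<in> {0..2 * pi}"
      by (auto simp: z_def field_simps)
    then have "\<bar>\<phi> (z + u) - \<phi> z\<bar> < \<epsilon>"
      using True by (intro \<delta>(2)) (auto simp: d_def)
    moreover have "\<phi> z = \<phi> x" "\<phi> (z + u) = \<phi> (x + u)"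
      using p.minus_of_int[of x k] p.minus_of_int[of "x + u" k] by (auto simp: z_def algebra_simps)
    ultimately show ?thesis using B(1) by (auto intro!: add_increasing2)
  next
    case False
    moreover have "d > 0" using \<open>\<delta> > 0\<close> by (simp add: d_def)
    ultimately have "1 \<le> u\<^sup>2 / d\<^sup>2"
      using abs_le_square_iff[of d u] by simp
    then have "2 * B * 1 \<le> 2 * B * (u\<^sup>2 / d\<^sup>2)"
      using B(1) by (intro mult_left_mono) auto
    then show ?thesis using B(2)[of "x + u"] B(2)[of x] \<open>\<epsilon> > 0\<close> by (auto simp: abs_le_iff)
  qed
  then show ?thesis using that[of "2 * B / d\<^sup>2"] B(1) by auto
qed

section \<open>Cosine series with nonnegative coefficients\<close>

lemma abs_mult_cos_le: "\<bar>c * cos x\<bar> \<le> \<bar>c\<bar>" for c x :: real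
  unfolding abs_mult by (rule mult_left_le) auto

lemma abs_mult_sin_le: "\<bar>c * sin x\<bar> \<le> \<bar>c\<bar>" for c x :: real
  unfolding abs_mult by (rule mult_left_le) auto

lemma summable_cos_series:
  assumes "summable (\<lambda>j. \<bar>c j :: real\<bar>)"
  shows "summable (\<lambda>j. c j * cos (real (Suc j) * x))"
  by (rule summable_comparison_test'[OF assms, of 0]) (simp only: real_norm_def abs_mult_cos_le)

lemma cos_series_continuous:
  assumes "summable (\<lambda>j. \<bar>c j :: real\<bar>)"
  shows "continuous_on UNIV (\<lambda>x. \<Sum>j. c j * cos (real (Suc j) * x))"
proof (rule uniform_limit_theorem)
  show "uniform_limit UNIV (\<lambda>n x. \<Sum>j<n. c j * cos (real (Suc j) * x))
      (\<lambda>x. \<Sum>j. c j * cos (real (Suc j) * x)) sequentially"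
    by (rule Weierstrass_m_test[OF _ assms]) (simp only: real_norm_def abs_mult_cos_le)
qed (auto intro!: always_eventually continuous_intros)

text \<open>The quotient \<open>(F 0 - F h) / h\<^sup>2\<close> stays bounded as \<open>h\<close> tends to 0 and, by nonnegativity, dominates
  every partial sum.\<close>

lemma cos_series_second_moment:
  fixes c :: "nat \<Rightarrow> real"
  assumes c: "\<And>j. 0 \<le> c j" "summable c"
    and F: "\<And>x. F x = a + (\<Sum>j. c j * cos (real (Suc j) * x))"
    and F': "\<And>x. (F has_real_derivative F' x) (at x)"
    and F'': "(F' has_real_derivative D) (at 0)"
  shows "summable (\<lambda>j. (real (Suc j))\<^sup>2 * c j)"
proof -
  have sc: "summable (\<lambda>j. c j * cos (real (Suc j) * x))" for x
    using c by (intro summable_cos_series) simp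
  \<comment> \<open>\<open>F\<close> is even, so \<open>F' 0 = 0\<close> and the difference quotient
    of \<open>F'\<close> at 0 is just \<open>F' h / h\<close>.\<close>
  have "F (- x) = F x" for x by (simp add: F)
  then have "((\<lambda>x. F (- x)) has_real_derivative F' 0) (at 0)"
    using F'[of 0] by simp
  moreover have "((\<lambda>x. F (- x)) has_real_derivative - F' 0) (at 0)"
    using DERIV_chain2[of F "F' 0" "\<lambda>x. - x" 0 "- 1" UNIV] F'[of 0]
    by (simp add: DERIV_minus)
  ultimately have "F' 0 = - F' 0"
    by (rule DERIV_unique)
  then have F'0: "F' 0 = 0" by simp
  have "((\<lambda>h. F' h / h) \<longlongrightarrow> D) (at 0)"
    using F''[unfolded DERIV_def] by (simp add: F'0)
  then have "\<forall>\<^sub>F h in at 0. \<bar>F' h / h - D\<bar> < 1"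
    by (auto simp: tendsto_iff dist_real_def dest: spec[of _ 1])
  then obtain d where d: "d > 0" "\<And>h. h \<noteq> 0 \<Longrightarrow> \<bar>h\<bar> < d \<Longrightarrow> \<bar>F' h / h - D\<bar> < 1"
    by (auto simp: eventually_at dist_real_def)
  define B where "B = \<bar>D\<bar> + 1"
  \<comment> \<open>By the mean value theorem \<open>F 0 - F h = - h * F' z\<close> with
    \<open>0 < z < h\<close>, and near 0 \<open>\<bar>F' z\<bar> \<le> B * z\<close>. Of the second
    derivative only its existence at 0 enters.\<close>
  have bound: "(F 0 - F h) / h\<^sup>2 \<le> B" if h: "0 < h" "h < d" for h
  proof -
    obtain z where z: "0 < z" "z < h" "F h - F 0 = (h - 0) * F' z"
      using MVT2[of 0 h F F'] h F' by auto
    have "\<bar>F' z / z\<bar> \<le> B"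
      using d(2)[of z] z h unfolding B_def by linarith
    then have "\<bar>F' z\<bar> \<le> B * z" using z by (simp add: abs_divide field_simps)
    also have "\<dots> \<le> B * h" using z by (intro mult_left_mono) (auto simp: B_def)
    finally have "h * (- F' z) \<le> h * (B * h)"
      using h by (intro mult_left_mono) auto
    also have "h * (- F' z) = F 0 - F h" using z by simp
    finally show ?thesis using h by (simp add: divide_le_eq power2_eq_square mult_ac)
  qed
  have partial: "(\<Sum>j<N. c j * ((1 - cos (real (Suc j) * h)) / h\<^sup>2)) \<le> B" if h: "0 < h" "h < d" for N h
  proof -
    have "(\<Sum>j<N. c j * (1 - cos (real (Suc j) * h))) \<le> (\<Sum>j. c j * (1 - cos (real (Suc j) * h)))"
      using summable_diff[OF c(2) sc[of h]] c(1)
      by (intro sum_le_suminf) (auto simp: right_diff_distrib intro!: mult_left_le)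
    also have "\<dots> = F 0 - F h"
      using suminf_diff[OF c(2) sc[of h]] by (simp add: F algebra_simps)
    finally have "(\<Sum>j<N. c j * (1 - cos (real (Suc j) * h))) / h\<^sup>2 \<le> (F 0 - F h) / h\<^sup>2"
      by (rule divide_right_mono) simp
    then show ?thesis using bound[OF h] by (simp add: sum_divide_distrib)
  qed
  have half: "((\<lambda>h. (1 - cos (k * h)) / h\<^sup>2) \<longlongrightarrow> k\<^sup>2 / 2) (at_right 0)" for k :: real
  proof -
    \<comment> \<open>The half-angle formula
      \<open>1 - cos (k * h) = 2 * (sin (k / 2 * h))\<^sup>2\<close> reduces the limit to that of
      \<open>sin x / x\<close>. For \<open>k = 0\<close> the argument \<open>k / 2 * h\<close> does
      not approach 0 through nonzero values, so that case is separate.\<close>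
    have "((\<lambda>h. 2 * (k / 2 * (sin (k / 2 * h) / (k / 2 * h)))\<^sup>2) \<longlongrightarrow> 2 * (k / 2 * 1)\<^sup>2) (at_right 0)"
      if "k \<noteq> 0"
    proof (intro tendsto_intros)
      have "filterlim (\<lambda>h. k / 2 * h) (at 0) (at_right 0)"
        using that by (auto simp: filterlim_at eventually_at_filter intro!: tendsto_eq_intros always_eventually)
      moreover have "((\<lambda>x::real. sin x / x) \<longlongrightarrow> 1) (at 0)"
        using DERIV_sin[of "0::real"] by (simp add: DERIV_def)
      ultimately show "((\<lambda>h. sin (k / 2 * h) / (k / 2 * h)) \<longlongrightarrow> 1) (at_right 0)"
        by (rule filterlim_compose[rotated])
    qed
    moreover have "(\<lambda>h. (1 - cos (k * h)) / h\<^sup>2) =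
        (\<lambda>h. 2 * (k / 2 * (sin (k / 2 * h) / (k / 2 * h)))\<^sup>2)" if "k \<noteq> 0"
      using that cos_double_sin[of "k / 2 * h" for h] by (auto simp: field_simps power2_eq_square)
    moreover have "2 * (k / 2 * 1)\<^sup>2 = k\<^sup>2 / 2"
      by (simp add: power2_eq_square)
    ultimately show ?thesis by (cases "k = 0") (simp, simp only: simp_thms)
  qed
  \<comment> \<open>In a finite sum \<open>h\<close> can tend to 0 termwise. The bound
    \<open>B\<close> does not depend on \<open>N\<close>, so the series of nonnegative terms
    converges.\<close>
  have "(\<Sum>j<N. c j * ((real (Suc j))\<^sup>2 / 2)) \<le> B" for N
  proof (rule tendsto_upperbound)
    show "((\<lambda>h. \<Sum>j<N. c j * ((1 - cos (real (Suc j) * h)) / h\<^sup>2)) \<longlongrightarrow>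
        (\<Sum>j<N. c j * ((real (Suc j))\<^sup>2 / 2))) (at_right 0)"
      by (intro tendsto_intros half)
    show "\<forall>\<^sub>F h in at_right 0. (\<Sum>j<N. c j * ((1 - cos (real (Suc j) * h)) / h\<^sup>2)) \<le> B"
      using eventually_at_right_less[of 0] eventually_at_right_real[OF d(1)]
      by eventually_elim (use partial in auto)
  qed simp
  then have "(\<Sum>j\<le>N. c j * ((real (Suc j))\<^sup>2 / 2)) \<le> B" for N
    unfolding lessThan_Suc_atMost[symmetric] .
  then have "summable (\<lambda>j. c j * ((real (Suc j))\<^sup>2 / 2))"
    using c(1) by (intro bounded_imp_summable[of _ B]) simp_all
  from summable_mult[OF this, of 2] show ?thesis by (simp add: mult_ac)
qed

text \<open>The second moment dominates both differentiated series, the first because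
  \<open>real (Suc j) \<le> (real (Suc j))\<^sup>2\<close>, so the Weierstrass test permits termwise
  differentiation twice.\<close>

lemma cos_series_deriv2:
  fixes c :: "nat \<Rightarrow> real"
  assumes c: "\<And>j. 0 \<le> c j" "summable c" "summable (\<lambda>j. (real (Suc j))\<^sup>2 * c j)"
    and F: "\<And>x. F x = a + (\<Sum>j. c j * cos (real (Suc j) * x))"
  shows "deriv (deriv F) x = - (\<Sum>j. (real (Suc j))\<^sup>2 * c j * cos (real (Suc j) * x))"
proof -
  have le: "real (Suc j) * c j \<le> (real (Suc j))\<^sup>2 * c j" for j
    using c(1) by (intro mult_right_mono) (auto simp: power2_eq_square)
  have s1: "summable (\<lambda>j. real (Suc j) * c j)"
    by (rule summable_comparison_test'[OF c(3), of 0]) (use le c(1) in auto)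
  have abs1: "\<bar>- (real (Suc j) * c j) * sin x\<bar> \<le> real (Suc j) * c j" for j x
    using abs_mult_sin_le[of "- (real (Suc j) * c j)" x] c(1)[of j] by (simp del: of_nat_Suc)
  have abs2: "\<bar>- ((real (Suc j))\<^sup>2 * c j * cos x)\<bar> \<le> (real (Suc j))\<^sup>2 * c j" for j x
    using abs_mult_cos_le[of "(real (Suc j))\<^sup>2 * c j" x] c(1)[of j] by (simp del: of_nat_Suc)
  have d1: "(F has_real_derivative (\<Sum>j. - (real (Suc j) * c j) * sin (real (Suc j) * x))) (at x)" for x
  proof -
    have "((\<lambda>x. \<Sum>j. c j * cos (real (Suc j) * x)) has_real_derivative
        (\<Sum>j. - (real (Suc j) * c j) * sin (real (Suc j) * x))) (at x)"
    proof (rule has_field_derivative_series'(2)[where S = UNIV and x = x and ?x0.0 = 0 and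
          f = "\<lambda>j x. c j * cos (real (Suc j) * x)" and
          f' = "\<lambda>j x. - (real (Suc j) * c j) * sin (real (Suc j) * x)"])
      show "uniformly_convergent_on UNIV (\<lambda>n x. \<Sum>i<n. - (real (Suc i) * c i) * sin (real (Suc i) * x))"
        by (rule Weierstrass_m_test'[OF _ s1]) (use abs1 in simp)
      show "summable (\<lambda>n. c n * cos (real (Suc n) * 0))" using c by simp
    qed (auto intro!: derivative_eq_intros)
    then show ?thesis by (subst F[abs_def]) (auto intro!: derivative_eq_intros)
  qed
  have d2: "((\<lambda>x. \<Sum>j. - (real (Suc j) * c j) * sin (real (Suc j) * x)) has_real_derivative
      (\<Sum>j. - ((real (Suc j))\<^sup>2 * c j * cos (real (Suc j) * x)))) (at x)" for x
  proof (rule has_field_derivative_series'(2)[where S = UNIV and x = x and ?x0.0 = 0])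
    show "uniformly_convergent_on UNIV (\<lambda>n x. \<Sum>i<n. - ((real (Suc i))\<^sup>2 * c i * cos (real (Suc i) * x)))"
      by (rule Weierstrass_m_test'[OF _ c(3)]) (use abs2 in simp)
  qed (auto intro!: derivative_eq_intros simp: power2_eq_square)
  have "deriv F = (\<lambda>x. \<Sum>j. - (real (Suc j) * c j) * sin (real (Suc j) * x))"
    using d1 by (auto intro!: DERIV_imp_deriv)
  moreover have "summable (\<lambda>j. (real (Suc j))\<^sup>2 * c j * cos (real (Suc j) * x))"
    using c by (intro summable_cos_series) simp
  ultimately show ?thesis
    using DERIV_imp_deriv[OF d2] suminf_minus[of "\<lambda>j. (real (Suc j))\<^sup>2 * c j * cos (real (Suc j) * x)"]
    by simp
qed

text \<open>Induction over pairs of derivatives: two derivatives turn cosines into cosines, so the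
  result is again a series to which \<open>cos_series_second_moment\<close> applies. The constant
  \<open>a\<close> survives only at order 0.\<close>

lemma cos_series_derivs:
  fixes c :: "nat \<Rightarrow> real"
  assumes c: "\<And>j. 0 \<le> c j" "summable c"
    and F: "\<And>x. F x = a + (\<Sum>j. c j * cos (real (Suc j) * x))"
    and d: "times_differentiable s F" and m: "2 * m \<le> s"
  shows "summable (\<lambda>j. real (Suc j) ^ (2 * m) * c j) \<and>
    (\<forall>x. (deriv ^^ (2 * m)) F x = (if m = 0 then a else 0) +
      (\<Sum>j. (- 1) ^ m * (real (Suc j) ^ (2 * m) * c j) * cos (real (Suc j) * x)))"
  using m
proof (induction m)
  case 0
  then show ?case using c F by simp
next
  case (Suc m)
  define b where "b j = real (Suc j) ^ (2 * m) * c j" for j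
  \<comment> \<open>The factor \<open>(- 1) ^ m\<close> undoes the alternating sign and restores
    nonnegative coefficients.\<close>
  define H where "H x = (- 1) ^ m * (deriv ^^ (2 * m)) F x" for x
  define a' where "a' = (- 1) ^ m * (if m = 0 then a else 0)"
  have IH: "summable b"
    "(deriv ^^ (2 * m)) F x = (if m = 0 then a else 0) + (\<Sum>j. (- 1) ^ m * b j * cos (real (Suc j) * x))" for x
    using Suc by (auto simp: b_def[abs_def])
  have b: "0 \<le> b j" for j using c by (simp add: b_def)
  have sb: "summable (\<lambda>j. b j * cos (real (Suc j) * x))" for x
    using IH b by (intro summable_cos_series) simp
  have H: "H x = a' + (\<Sum>j. b j * cos (real (Suc j) * x))" for x
    using suminf_mult[OF sb, of "(- 1) ^ m" x]
    by (simp add: H_def IH(2) a'_def distrib_left mult.assoc flip: power_add power_mult_distrib)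
  have DF: "((deriv ^^ (2 * m)) F has_real_derivative (deriv ^^ Suc (2 * m)) F x) (at x)"
    "((deriv ^^ Suc (2 * m)) F has_real_derivative (deriv ^^ Suc (Suc (2 * m))) F x) (at x)" for x
    using Suc.prems by (intro times_differentiableD[OF d]; simp)+
  have DH: "(H has_real_derivative (- 1) ^ m * (deriv ^^ Suc (2 * m)) F x) (at x)"
    "((\<lambda>x. (- 1) ^ m * (deriv ^^ Suc (2 * m)) F x) has_real_derivative
      (- 1) ^ m * (deriv ^^ Suc (Suc (2 * m))) F x) (at x)" for x
    unfolding H_def[abs_def] by (intro DERIV_cmult DF)+
  have s2: "summable (\<lambda>j. (real (Suc j))\<^sup>2 * b j)"
    by (rule cos_series_second_moment[OF b IH(1) H DH(1) DH(2)[of 0]])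
  have "deriv (deriv H) x = (- 1) ^ m * (deriv ^^ Suc (Suc (2 * m))) F x" for x
    using DERIV_imp_deriv[OF DH(1)] DERIV_imp_deriv[OF DH(2)]
    by (metis ext)
  then have "(- 1) ^ m * (deriv ^^ Suc (Suc (2 * m))) F x =
      - (\<Sum>j. (real (Suc j))\<^sup>2 * b j * cos (real (Suc j) * x))" for x
    using cos_series_deriv2[OF b IH(1) s2 H] by simp
  then have "(- 1) ^ m * ((- 1) ^ m * (deriv ^^ Suc (Suc (2 * m))) F x) =
      (- 1) ^ m * - (\<Sum>j. (real (Suc j))\<^sup>2 * b j * cos (real (Suc j) * x))" for x
    by simp
  then have "(deriv ^^ Suc (Suc (2 * m))) F x =
      (- 1) ^ Suc m * (\<Sum>j. (real (Suc j))\<^sup>2 * b j * cos (real (Suc j) * x))" for x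
    by (simp flip: mult.assoc power_mult_distrib)
  moreover have "summable (\<lambda>j. (real (Suc j))\<^sup>2 * b j * cos (real (Suc j) * x))" for x
    using s2 b by (intro summable_cos_series) simp
  ultimately have "(deriv ^^ (2 * Suc m)) F x =
      (\<Sum>j. (- 1) ^ Suc m * ((real (Suc j))\<^sup>2 * b j * cos (real (Suc j) * x)))" for x
    by (subst suminf_mult) (simp_all)
  moreover have "(real (Suc j))\<^sup>2 * b j = real (Suc j) ^ (2 * Suc m) * c j" for j
    by (simp add: b_def power2_eq_square)
  ultimately show ?case using s2 by (simp only: mult.assoc) simp
qed

text \<open>Each term is bounded by \<open>B * \<bar>b j\<bar>\<close> on a set of finite measure,
  so absolute summability permits exchanging sum and integral.\<close>

lemma cint_cos_series:
  assumes b: "summable (\<lambda>j. \<bar>b j :: real\<bar>)" and \<phi>: "continuous_on UNIV \<phi>"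
  shows "cint (\<lambda>x. \<phi> x * (a + (\<Sum>j. b j * cos (real (Suc j) * x)))) =
    a * cint \<phi> + (\<Sum>j. b j * cint (\<lambda>x. \<phi> x * cos (real (Suc j) * x)))"
proof -
  \<comment> \<open>\<open>\<phi>\<close> may fail to be periodic, as for \<open>x\<^sup>2\<close>
    in \<open>h_kernel_eq\<close>, so its bound comes from the closed interval.\<close>
  have "compact (\<phi> ` {-pi..pi})"
    by (intro compact_continuous_image continuous_on_subset[OF \<phi>]) auto
  then obtain B where B: "B > 0" "\<And>x. x \<in> {-pi..pi} \<Longrightarrow> \<bar>\<phi> x\<bar> \<le> B"
    by (metis (no_types) bounded_pos compact_imp_bounded imageI real_norm_def)
  define g where "g j x = indicator {-pi..<pi} x *\<^sub>R (b j * (\<phi> x * cos (real (Suc j) * x)))" for j x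
  have ig: "integrable lborel (g j)" for j
    unfolding g_def[abs_def] set_integrable_def[symmetric]
    by (intro cint_integrable continuous_intros \<phi>)
  have gb': "norm (g j x) \<le> B * \<bar>b j\<bar>" if "norm (g j x) \<le> indicator {-pi..<pi} x * (B * \<bar>b j\<bar>)" for j x
    by (rule order.trans[OF that]) (use B(1) in \<open>auto simp: indicator_def\<close>)
  have gb: "norm (g j x) \<le> indicator {-pi..<pi} x * (B * \<bar>b j\<bar>)" for j x
  proof -
    have "\<bar>\<phi> x * cos (real (Suc j) * x)\<bar> \<le> B * 1" if "x \<in> {-pi..<pi}"
      unfolding abs_mult using B that by (intro mult_mono) auto
    then have "\<bar>b j\<bar> * \<bar>\<phi> x * cos (real (Suc j) * x)\<bar> \<le> \<bar>b j\<bar> * B" if "x \<in> {-pi..<pi}"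
      using that by (intro mult_left_mono) auto
    then show ?thesis by (auto simp: g_def indicator_def abs_mult mult_ac)
  qed
  have "(\<integral>x. (\<Sum>j. g j x) \<partial>lborel) = (\<Sum>j. \<integral>x. g j x \<partial>lborel)"
  proof (rule integral_suminf[OF ig])
    show "AE x in lborel. summable (\<lambda>j. norm (g j x))"
      by (rule AE_I2, rule summable_comparison_test'[OF summable_mult[OF b, of B], of 0])
         (use gb'[OF gb] in simp)
    have "(\<integral>x. norm (g j x) \<partial>lborel) \<le> 2 * pi * (B * \<bar>b j\<bar>)" for j
    proof -
      have "(\<integral>x. norm (g j x) \<partial>lborel) \<le> cint (\<lambda>x. B * \<bar>b j\<bar>)"
        unfolding set_lebesgue_integral_def
        using gb ig cint_integrable[of "\<lambda>x. B * \<bar>b j\<bar>"]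
        by (intro integral_mono) (auto simp: set_integrable_def)
      then show ?thesis by (simp only: cint_const)
    qed
    then show "summable (\<lambda>j. \<integral>x. norm (g j x) \<partial>lborel)"
      by (intro summable_comparison_test'[OF summable_mult[OF summable_mult[OF b, of B], of "2 * pi"], of 0])
        simp
  qed
  also have "\<dots> = (\<Sum>j. b j * cint (\<lambda>x. \<phi> x * cos (real (Suc j) * x)))"
    unfolding g_def set_lebesgue_integral_def[symmetric] set_integral_mult_right ..
  also have "(\<integral>x. (\<Sum>j. g j x) \<partial>lborel) = cint (\<lambda>x. \<phi> x * (\<Sum>j. b j * cos (real (Suc j) * x)))"
  proof -
    have "(\<Sum>j. g j x) = indicator {-pi..<pi} x *\<^sub>R (\<phi> x * (\<Sum>j. b j * cos (real (Suc j) * x)))" for x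
      using suminf_mult[OF summable_cos_series[OF b], of "indicator {-pi..<pi} x * \<phi> x" x]
      by (simp add: g_def mult_ac)
    then show ?thesis by (simp add: set_lebesgue_integral_def)
  qed
  finally have "cint (\<lambda>x. \<phi> x * (\<Sum>j. b j * cos (real (Suc j) * x))) =
      (\<Sum>j. b j * cint (\<lambda>x. \<phi> x * cos (real (Suc j) * x)))" .
  moreover have "cint (\<lambda>x. \<phi> x * a + \<phi> x * (\<Sum>j. b j * cos (real (Suc j) * x))) =
      cint (\<lambda>x. \<phi> x * a) + cint (\<lambda>x. \<phi> x * (\<Sum>j. b j * cos (real (Suc j) * x)))"
    by (intro cint_add continuous_intros \<phi> cos_series_continuous[OF b])
  ultimately show ?thesis by (simp add: distrib_left mult.commute)
qed

section \<open>Trigonometric integrals and Parseval's identity\<close>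

lemma cos_nat_pi: "cos (real j * pi) = (- 1) ^ j" "sin (real j * pi) = 0"
  by (simp_all add: mult.commute)

lemma cint_cos: "cint (\<lambda>x. cos (real (Suc j) * x)) = 0"
proof -
  have "cint (\<lambda>x. cos (real (Suc j) * x)) =
      sin (real (Suc j) * pi) / real (Suc j) - sin (real (Suc j) * (- pi)) / real (Suc j)"
    by (rule cint_FTC) (auto intro!: derivative_eq_intros continuous_intros simp del: of_nat_Suc)
  also have "\<dots> = 0" by (simp add: cos_nat_pi del: of_nat_Suc)
  finally show ?thesis .
qed

lemma cint_cos_cos:
  "cint (\<lambda>x. cos (real (Suc k) * x) * cos (real (Suc j) * x)) = (if j = k then pi else 0)"
proof -
  \<comment> \<open>The frequency \<open>k + j + 2\<close> is \<open>Suc (Suc k + j)\<close> in the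
    indexing of \<open>cint_cos\<close>; the differences below are shifted likewise.\<close>
  have sum: "cint (\<lambda>x. cos (real (Suc k) * x + real (Suc j) * x)) = 0"
    using cint_cos[of "Suc k + j"] by (simp add: algebra_simps)
  have diff: "cint (\<lambda>x. cos (real (Suc k) * x - real (Suc j) * x)) = (if j = k then 2 * pi else 0)"
  proof (cases j k rule: linorder_cases)
    case less
    then have "cos (real (Suc k) * x - real (Suc j) * x) = cos (real (Suc (k - j - 1)) * x)" for x
      by (intro arg_cong[where f = cos]) (simp add: algebra_simps of_nat_diff)
    then show ?thesis using less cint_cos[of "k - j - 1"] by simp
  next
    case equal
    then show ?thesis using cint_const[of 1] by simp
  next
    case greater
    then have "cos (real (Suc k) * x - real (Suc j) * x) = cos (- (real (Suc (j - k - 1)) * x))" for x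
      by (intro arg_cong[where f = cos]) (simp add: algebra_simps of_nat_diff)
    then show ?thesis using greater cint_cos[of "j - k - 1"] by simp
  qed
  have "cint (\<lambda>x. cos (real (Suc k) * x) * cos (real (Suc j) * x)) =
    cint (\<lambda>x. (cos (real (Suc k) * x - real (Suc j) * x) + cos (real (Suc k) * x + real (Suc j) * x)) / 2)"
    by (simp only: cos_times_cos)
  also have "\<dots> = (cint (\<lambda>x. cos (real (Suc k) * x - real (Suc j) * x)) +
      cint (\<lambda>x. cos (real (Suc k) * x + real (Suc j) * x))) / 2"
    by (subst set_integral_divide_zero, subst cint_add) (auto intro!: continuous_intros)
  also have "\<dots> = (if j = k then pi else 0)"
    unfolding sum diff by simp
  finally show ?thesis .
qed

lemma cint_square: "cint (\<lambda>x. x\<^sup>2) = 2 * pi ^ 3 / 3"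
proof -
  have "cint (\<lambda>x. x\<^sup>2) = pi ^ 3 / 3 - (- pi) ^ 3 / 3"
    by (rule cint_FTC) (auto intro!: derivative_eq_intros continuous_intros simp: power2_eq_square)
  then show ?thesis by (simp add: power3_eq_cube)
qed

lemma cint_square_cos:
  "cint (\<lambda>x. x\<^sup>2 * cos (real (Suc j) * x)) = 4 * pi * (- 1) ^ Suc j / (real (Suc j))\<^sup>2"
proof -
  define k where "k = real (Suc j)"
  have k: "k \<noteq> 0" by (simp add: k_def)
  \<comment> \<open>The antiderivative obtained from two integrations by parts. At the endpoints the
    sines vanish, and the middle term leaves
    \<open>4 * pi * cos (k * pi) / k\<^sup>2\<close>.\<close>
  define P where "P x = x\<^sup>2 * sin (k * x) / k + 2 * x * cos (k * x) / k\<^sup>2 - 2 * sin (k * x) / k ^ 3" for x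
  have "cint (\<lambda>x. x\<^sup>2 * cos (k * x)) = P pi - P (- pi)"
    unfolding P_def
    by (rule cint_FTC) (use k in \<open>auto intro!: derivative_eq_intros continuous_intros
      simp: field_simps power2_eq_square power3_eq_cube\<close>)
  also have "\<dots> = 4 * pi * cos (k * pi) / k\<^sup>2"
    using cos_nat_pi(2)[of "Suc j"] by (simp add: P_def k_def del: of_nat_Suc)
  finally show ?thesis using cos_nat_pi(1)[of "Suc j"] by (simp add: k_def del: of_nat_Suc)
qed

text \<open>Only one factor of \<open>(G x)\<^sup>2\<close> is expanded; the integrals left over are
  Fourier coefficients of \<open>G\<close>, found by the same expansion. The squares are summable
  since \<open>\<bar>b j\<bar> < 1\<close> eventually.\<close>

lemma cos_series_parseval:
  fixes b :: "nat \<Rightarrow> real"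
  assumes b: "summable (\<lambda>j. \<bar>b j\<bar>)"
    and G: "\<And>x. G x = a + (\<Sum>j. b j * cos (real (Suc j) * x))"
  shows "cint (\<lambda>x. (G x)\<^sup>2) = 2 * pi * a\<^sup>2 + pi * (\<Sum>j. (b j)\<^sup>2)"
    "summable (\<lambda>j. (b j)\<^sup>2)"
proof -
  have cG: "continuous_on UNIV G"
    by (subst G[abs_def]) (intro continuous_intros cos_series_continuous[OF b])
  have "cint G = cint (\<lambda>x. 1 * (a + (\<Sum>j. b j * cos (real (Suc j) * x))))"
    by (simp add: G)
  also have "\<dots> = a * (2 * pi)"
    using cint_const[of 1] by (subst cint_cos_series[OF b]) (simp_all add: cint_cos del: of_nat_Suc)
  finally have G0: "cint G = a * (2 * pi)" .
  have Gk: "cint (\<lambda>x. G x * cos (real (Suc k) * x)) = pi * b k" for k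
  proof -
    have "cint (\<lambda>x. G x * cos (real (Suc k) * x)) =
        cint (\<lambda>x. cos (real (Suc k) * x) * (a + (\<Sum>j. b j * cos (real (Suc j) * x))))"
      by (simp add: G mult.commute)
    also have "\<dots> = (\<Sum>j. b j * (if j = k then pi else 0))"
      by (subst cint_cos_series[OF b]) (auto simp: cint_cos cint_cos_cos intro!: continuous_intros simp del: of_nat_Suc)
    also have "\<dots> = b k * pi"
      by (subst suminf_finite[of "{k}"]) auto
    finally show ?thesis by simp
  qed
  have "(\<lambda>j. \<bar>b j\<bar>) \<longlonglongrightarrow> 0" by (rule summable_LIMSEQ_zero[OF b])
  then have "\<forall>\<^sub>F j in sequentially. \<bar>b j\<bar> < 1"
    by (rule order_tendstoD(2)) simp
  then have "\<forall>\<^sub>F j in sequentially. norm ((b j)\<^sup>2) \<le> \<bar>b j\<bar>"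
  proof eventually_elim
    case (elim j)
    then have "\<bar>b j\<bar> * \<bar>b j\<bar> \<le> \<bar>b j\<bar>" by (intro mult_left_le) auto
    then show ?case by (simp add: power2_eq_square)
  qed
  then show s: "summable (\<lambda>j. (b j)\<^sup>2)"
    by (rule summable_comparison_test_ev[OF _ b])
  have "cint (\<lambda>x. (G x)\<^sup>2) = cint (\<lambda>x. G x * (a + (\<Sum>j. b j * cos (real (Suc j) * x))))"
    by (simp add: G power2_eq_square)
  also have "\<dots> = a * (a * (2 * pi)) + (\<Sum>j. b j * (pi * b j))"
    by (subst cint_cos_series[OF b cG]) (simp add: G0 Gk del: of_nat_Suc)
  also have "(\<Sum>j. b j * (pi * b j)) = pi * (\<Sum>j. (b j)\<^sup>2)"
    using suminf_mult[OF s, of pi] by (simp add: power2_eq_square mult_ac)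
  finally show "cint (\<lambda>x. (G x)\<^sup>2) = 2 * pi * a\<^sup>2 + pi * (\<Sum>j. (b j)\<^sup>2)"
    by (simp add: power2_eq_square mult_ac)
qed

section \<open>The kernel and its local averages\<close>

text \<open>At \<open>x = 0\<close> every cosine is 1, so pointwise convergence there is summability
  of the coefficients, which is absolute because they are nonnegative.\<close>

lemma kernel_cos_series:
  assumes L: "circular_kernel_family L" and r: "r \<in> {0..<1}"
  shows "kernel_coeff L (Suc j) r \<ge> 0"
    "summable (\<lambda>j. kernel_coeff L (Suc j) r / pi)"
    "L r x = 1 / (2 * pi) + (\<Sum>j. kernel_coeff L (Suc j) r / pi * cos (real (Suc j) * x))"
proof -
  let ?\<alpha> = "\<lambda>j. kernel_coeff L (Suc j) r"
  have *: "\<forall>j\<ge>1. kernel_coeff L j r \<in> {0..1}"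
    "summable (\<lambda>j. ?\<alpha> j * cos (real (Suc j) * x))"
    "L r x = 1 / (2 * pi) * (1 + 2 * (\<Sum>j. ?\<alpha> j * cos (real (Suc j) * x)))" for x
    using L r unfolding circular_kernel_family_def by blast+
  show "?\<alpha> j \<ge> 0"
    using *(1) by simp
  have "summable ?\<alpha>"
    using *(2)[of 0] by simp
  then show "summable (\<lambda>j. ?\<alpha> j / pi)"
    by (rule summable_divide)
  have "(\<Sum>j. ?\<alpha> j / pi * cos (real (Suc j) * x)) = (\<Sum>j. ?\<alpha> j * cos (real (Suc j) * x)) / pi"
    using suminf_divide[OF *(2)[of x], of pi] by simp
  then show "L r x = 1 / (2 * pi) + (\<Sum>j. ?\<alpha> j / pi * cos (real (Suc j) * x))"
    unfolding *(3)[of x] by (simp add: field_simps)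
qed

lemma kernel_deriv_cos_series:
  assumes L: "circular_kernel_family L" and r: "r \<in> {0..<1}"
    and s: "even s" and d: "times_differentiable s (L r)"
  defines "b \<equiv> \<lambda>j. (- 1) ^ (s div 2) * (real (Suc j) ^ s * (kernel_coeff L (Suc j) r / pi))"
  shows "summable (\<lambda>j. \<bar>b j\<bar>)"
    "(deriv ^^ s) (L r) x = (if s = 0 then 1 / (2 * pi) else 0) + (\<Sum>j. b j * cos (real (Suc j) * x))"
proof -
  have s2: "2 * (s div 2) = s" "s div 2 = 0 \<longleftrightarrow> s = 0" using s by auto
  have nonneg: "0 \<le> kernel_coeff L (Suc j) r / pi" for j
    using kernel_cos_series(1)[OF L r] by simp
  have *: "summable (\<lambda>j. real (Suc j) ^ s * (kernel_coeff L (Suc j) r / pi)) \<and>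
    (\<forall>x. (deriv ^^ s) (L r) x = (if s = 0 then 1 / (2 * pi) else 0) + (\<Sum>j. b j * cos (real (Suc j) * x)))"
    using cos_series_derivs[OF nonneg kernel_cos_series(2,3)[OF L r] d, of "s div 2"]
    unfolding s2 b_def by simp
  then show "(deriv ^^ s) (L r) x = (if s = 0 then 1 / (2 * pi) else 0) + (\<Sum>j. b j * cos (real (Suc j) * x))"
    by blast
  show "summable (\<lambda>j. \<bar>b j\<bar>)"
    using * kernel_cos_series(1)[OF L r] by (simp add: b_def abs_mult power_abs)
qed

text \<open>Existence of the derivative of order \<open>s\<close> alone does not make it continuous;
  the absolutely convergent series does.\<close>

lemma kernel_deriv_continuous:
  assumes "circular_kernel_family L" "r \<in> {0..<1}" "even s" "times_differentiable s (L r)"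
  shows "continuous_on UNIV ((deriv ^^ s) (L r))"
  unfolding kernel_deriv_cos_series(2)[OF assms, abs_def]
  by (intro continuous_intros cos_series_continuous kernel_deriv_cos_series(1)[OF assms])

lemma kernel_deriv_even:
  assumes "circular_kernel_family L" "r \<in> {0..<1}" "even s" "times_differentiable s (L r)"
  shows "(deriv ^^ s) (L r) (- x) = (deriv ^^ s) (L r) x"
  unfolding kernel_deriv_cos_series(2)[OF assms] by simp

text \<open>The sign convention in \<open>R_kernel\<close> for \<open>t = 1\<close> is the factor
  left by differentiating a cosine \<open>s\<close> times.\<close>

lemma minus_one_power_half:
  assumes "even s"
  shows "(- 1 :: real) ^ (s div 2) = (if s mod 4 = 2 then - 1 else 1)"
proof -
  obtain m where m: "s = 2 * m" using assms by blast
  have "s mod 4 = 2 \<longleftrightarrow> odd m" unfolding m by presburger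
  then show ?thesis using m by auto
qed

text \<open>All cosines are 1 at 0. Every term of the estimator with equal indices has this value,
  which is how \<open>R_kernel L s 1\<close> enters the bias.\<close>

lemma R_kernel_1_eq:
  assumes "circular_kernel_family L" "r \<in> {0..<1}" "even s" "times_differentiable s (L r)"
  shows "R_kernel L s 1 r = (deriv ^^ s) (L r) 0"
proof -
  let ?\<alpha> = "\<lambda>j. kernel_coeff L (Suc j) r"
  have "summable (\<lambda>j. \<bar>(- 1) ^ (s div 2) * (real (Suc j) ^ s * (?\<alpha> j / pi))\<bar>)"
    by (rule kernel_deriv_cos_series(1)[OF assms])
  then have "summable (\<lambda>j. real (Suc j) ^ s * ?\<alpha> j / pi)"
    using kernel_cos_series(1)[OF assms(1,2)] by (simp add: abs_mult power_abs)
  from summable_mult[OF this, of pi] have s: "summable (\<lambda>j. real (Suc j) ^ s * ?\<alpha> j)"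
    by simp
  have "(\<Sum>j. (- 1) ^ (s div 2) / pi * (real (Suc j) ^ s * ?\<alpha> j)) =
      (- 1) ^ (s div 2) / pi * (\<Sum>j. real (Suc j) ^ s * ?\<alpha> j)"
    by (rule suminf_mult[OF s])
  then have "(deriv ^^ s) (L r) 0 =
      (if s = 0 then 1 / (2 * pi) else 0) + (- 1) ^ (s div 2) / pi * (\<Sum>j. real (Suc j) ^ s * ?\<alpha> j)"
    unfolding kernel_deriv_cos_series(2)[OF assms] by (simp add: field_simps)
  then show ?thesis
    unfolding minus_one_power_half[OF assms(3)] by (auto simp: R_kernel_def field_simps)
qed

text \<open>Parseval's identity. Squaring removes the sign, and the constant term contributes
  \<open>2 * pi * (1 / (2 * pi))\<^sup>2 = 1 / (2 * pi)\<close> exactly when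
  \<open>s = 0\<close>.\<close>

lemma R_kernel_2_eq:
  assumes "circular_kernel_family L" "r \<in> {0..<1}" "even s" "times_differentiable s (L r)"
  shows "R_kernel L s 2 r = cint (\<lambda>x. ((deriv ^^ s) (L r) x)\<^sup>2)"
proof -
  let ?\<alpha> = "\<lambda>j. kernel_coeff L (Suc j) r"
  let ?b = "\<lambda>j. (- 1) ^ (s div 2) * (real (Suc j) ^ s * (?\<alpha> j / pi))"
  note parseval = cos_series_parseval[OF kernel_deriv_cos_series[OF assms]]
  have b2: "(?b j)\<^sup>2 = real (Suc j) ^ (2 * s) * ?\<alpha> j ^ 2 / pi\<^sup>2" for j
    by (simp add: power_mult_distrib power_divide power_mult[symmetric] mult.commute del: of_nat_Suc)
  have s: "summable (\<lambda>j. real (Suc j) ^ (2 * s) * ?\<alpha> j ^ 2)"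
    using summable_mult[OF parseval(2), of "pi\<^sup>2"] by (simp only: b2) simp
  have "pi * (\<Sum>j. (?b j)\<^sup>2) = (\<Sum>j. real (Suc j) ^ (2 * s) * ?\<alpha> j ^ 2) / pi"
    unfolding b2 suminf_divide[OF s] by (simp add: power2_eq_square)
  then have "cint (\<lambda>x. ((deriv ^^ s) (L r) x)\<^sup>2) = 2 * pi * (if s = 0 then 1 / (2 * pi) else 0)\<^sup>2 +
      (\<Sum>j. real (Suc j) ^ (2 * s) * ?\<alpha> j ^ 2) / pi"
    unfolding parseval(1) by simp
  also have "2 * pi * (if s = 0 then 1 / (2 * pi) else 0)\<^sup>2 = (if s = 0 then 1 / (2 * pi) else 0)"
    by (simp add: power2_eq_square)
  finally show ?thesis
    by (cases "s = 0") (simp_all add: R_kernel_def add_divide_distrib)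
qed

lemma kernel_continuous:
  assumes "circular_kernel_family L" "r \<in> {0..<1}"
  shows "continuous_on UNIV (L r)"
  using kernel_deriv_continuous[OF assms, of 0] by (simp add: times_differentiable_def)

text \<open>The term \<open>pi\<^sup>2 / 3\<close> is the second moment of the uniform density
  \<open>1 / (2 * pi)\<close>; the series collects the integrals of \<open>x\<^sup>2\<close> against
  the cosines.\<close>

lemma h_kernel_eq:
  assumes "circular_kernel_family L" "r \<in> {0..<1}"
  shows "h_kernel L r = cint (\<lambda>x. x\<^sup>2 * L r x)"
proof -
  let ?\<alpha> = "\<lambda>j. kernel_coeff L (Suc j) r"
  have s: "summable (\<lambda>j. \<bar>?\<alpha> j / pi\<bar>)"
    using kernel_cos_series(1,2)[OF assms] by simp
  have "cint (\<lambda>x. x\<^sup>2 * L r x) =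
      1 / (2 * pi) * (2 * pi ^ 3 / 3) + (\<Sum>j. ?\<alpha> j / pi * (4 * pi * (- 1) ^ Suc j / (real (Suc j))\<^sup>2))"
    by (simp only: kernel_cos_series(3)[OF assms])
       (subst cint_cos_series[OF s], auto intro!: continuous_intros simp only: cint_square cint_square_cos)
  also have "(\<Sum>j. ?\<alpha> j / pi * (4 * pi * (- 1) ^ Suc j / (real (Suc j))\<^sup>2)) =
      (\<Sum>j. 4 * ((- 1) ^ Suc j * ?\<alpha> j / (real (Suc j))\<^sup>2))"
    by (intro suminf_cong) (simp add: field_simps)
  also have "\<dots> = 4 * (\<Sum>j. (- 1) ^ Suc j * ?\<alpha> j / (real (Suc j))\<^sup>2)"
  proof (rule suminf_mult)
    have le: "\<bar>?\<alpha> j\<bar> / (real (Suc j))\<^sup>2 \<le> \<bar>?\<alpha> j\<bar>" for j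
      by (simp add: divide_le_eq mult_left_le_one_le) (simp add: power2_eq_square algebra_simps)
    show "summable (\<lambda>j. (- 1) ^ Suc j * ?\<alpha> j / (real (Suc j))\<^sup>2)"
      by (rule summable_comparison_test'[OF summable_mult[OF s, of pi], of 0])
         (use le in \<open>auto simp: abs_mult\<close>)
  qed
  finally show ?thesis by (simp add: h_kernel_def power2_eq_square power3_eq_cube)
qed

section \<open>Averages of continuous and smooth functions near a point\<close>

lemma local_average:
  assumes Q: "continuous_on UNIV Q" "\<And>u. 0 \<le> Q u" and p: "continuous_on UNIV p"
    and mod: "\<And>u. \<bar>p (y + u) - p y\<bar> \<le> \<epsilon> + C * u\<^sup>2"
  shows "\<bar>cint (\<lambda>u. Q u * p (y + u)) - p y * cint Q\<bar> \<le> \<epsilon> * cint Q + C * cint (\<lambda>u. u\<^sup>2 * Q u)"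
proof -
  \<comment> \<open>\<open>Q\<close> is not normalized: it will be \<open>(G n)\<^sup>2\<close> with
    mass \<open>R n\<close>, so the error is measured in multiples of \<open>cint Q\<close>.\<close>
  have "\<bar>cint (\<lambda>u. Q u * p (y + u)) - cint (\<lambda>u. p y * Q u)\<bar> \<le> cint (\<lambda>u. \<epsilon> * Q u + C * (u\<^sup>2 * Q u))"
  proof (rule cint_abs_diff_le)
    fix u
    have "\<bar>Q u * p (y + u) - p y * Q u\<bar> = Q u * \<bar>p (y + u) - p y\<bar>"
      using Q(2)[of u] abs_mult[of "Q u" "p (y + u) - p y"] by (simp add: algebra_simps)
    also have "\<dots> \<le> Q u * (\<epsilon> + C * u\<^sup>2)"
      using mod Q(2) by (intro mult_left_mono)
    finally show "\<bar>Q u * p (y + u) - p y * Q u\<bar> \<le> \<epsilon> * Q u + C * (u\<^sup>2 * Q u)"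
      by (simp add: algebra_simps)
  qed (intro continuous_intros Q continuous_on_compose2[OF p] subset_UNIV)+
  also have "cint (\<lambda>u. \<epsilon> * Q u + C * (u\<^sup>2 * Q u)) = \<epsilon> * cint Q + C * cint (\<lambda>u. u\<^sup>2 * Q u)"
    by (subst cint_add) (auto intro!: continuous_intros Q)
  finally show ?thesis by simp
qed

text \<open>Taylor's formula with Lagrange remainder. The linear term integrates to 0 because
  \<open>u * K u\<close> is odd; the modulus of \<open>p2\<close>, multiplied by
  \<open>u\<^sup>2 * K u\<close>, turns into a second and a fourth moment.\<close>

lemma local_average_second_order:
  assumes K: "continuous_on UNIV K" "\<And>u. 0 \<le> K u" "\<And>u. K (- u) = K u" "cint K = 1"
    and p: "\<And>x. (p has_real_derivative p1 x) (at x)" "\<And>x. (p1 has_real_derivative p2 x) (at x)"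
    and C: "C \<ge> 0" and mod: "\<And>u. \<bar>p2 (y + u) - p2 y\<bar> \<le> \<epsilon> + C * u\<^sup>2"
  shows "\<bar>cint (\<lambda>u. K u * p (y + u)) - (p y + cint (\<lambda>u. u\<^sup>2 * K u) / 2 * p2 y)\<bar>
    \<le> \<epsilon> * cint (\<lambda>u. u\<^sup>2 * K u) + C * cint (\<lambda>u. u ^ 4 * K u)"
proof -
  have cp: "continuous_on UNIV p"
    using p by (auto simp: continuous_on_eq_continuous_at intro: DERIV_isCont)
  let ?T = "\<lambda>u. p y * K u + (p1 y * (u * K u) + p2 y / 2 * (u\<^sup>2 * K u))"
  have odd: "cint (\<lambda>u. u * K u) = 0"
  proof -
    have "continuous_on UNIV (\<lambda>u. u * K u)" by (intro continuous_intros K)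
    from cint_uminus_arg[OF this] set_integral_mult_right[of lborel "{-pi..<pi}" "- 1" "\<lambda>u. u * K u"]
    show ?thesis by (simp add: K(3))
  qed
  have "\<bar>cint (\<lambda>u. K u * p (y + u)) - cint ?T\<bar> \<le> cint (\<lambda>u. \<epsilon> * (u\<^sup>2 * K u) + C * (u ^ 4 * K u))"
  proof (rule cint_abs_diff_le)
    fix u
    define diff where "diff m x = (if m = 0 then p (y + x) else if m = 1 then p1 (y + x) else p2 (y + x))"
      for m :: nat and x
    \<comment> \<open>\<open>p2\<close> is known only through its modulus of continuity, so the
      expansion stops at order two with \<open>p2\<close> at an intermediate point
      \<open>y + t\<close>.\<close>
    have "\<exists>t. \<bar>t\<bar> \<le> \<bar>u\<bar> \<and> p (y + u) = (\<Sum>m<2. diff m 0 / fact m * u ^ m) + diff 2 t / fact 2 * u ^ 2"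
    proof (rule Maclaurin_bi_le)
      have "((\<lambda>x. p (y + x)) has_real_derivative p1 (y + t)) (at t)"
        "((\<lambda>x. p1 (y + x)) has_real_derivative p2 (y + t)) (at t)" for t
        using p(1)[of "t + y"] p(2)[of "t + y"] by (simp_all add: DERIV_shift add.commute)
      then show "\<forall>m t. m < 2 \<and> \<bar>t\<bar> \<le> \<bar>u\<bar> \<longrightarrow> (diff m has_real_derivative diff (Suc m) t) (at t)"
        by (auto simp: diff_def[abs_def] less_2_cases_iff)
    qed (simp add: diff_def[abs_def])
    then obtain t where t: "\<bar>t\<bar> \<le> \<bar>u\<bar>" "p (y + u) = p y + p1 y * u + p2 (y + t) / 2 * u\<^sup>2"
      by (auto simp: diff_def numeral_2_eq_2)
    have "K u * p (y + u) - ?T u = (p2 (y + t) - p2 y) * (u\<^sup>2 * K u) / 2"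
      unfolding t by (simp add: field_simps power2_eq_square)
    then have "\<bar>K u * p (y + u) - ?T u\<bar> = \<bar>p2 (y + t) - p2 y\<bar> * (u\<^sup>2 * K u) / 2"
      by (simp only: abs_divide abs_mult) (simp add: K(2))
    also have "\<dots> \<le> \<bar>p2 (y + t) - p2 y\<bar> * (u\<^sup>2 * K u)"
      using K(2)[of u] by simp
    also have "\<dots> \<le> (\<epsilon> + C * u\<^sup>2) * (u\<^sup>2 * K u)"
    proof (rule mult_right_mono)
      \<comment> \<open>As \<open>\<bar>t\<bar> \<le> \<bar>u\<bar>\<close> and
        \<open>C \<ge> 0\<close>, the modulus at the unknown \<open>t\<close> is at most the one at
        \<open>u\<close>.\<close>
      have "C * t\<^sup>2 \<le> C * u\<^sup>2"
        using t(1) C by (intro mult_left_mono) (auto simp: abs_le_square_iff)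
      then show "\<bar>p2 (y + t) - p2 y\<bar> \<le> \<epsilon> + C * u\<^sup>2" using mod[of t] by linarith
    qed (use K in simp)
    finally show "\<bar>K u * p (y + u) - ?T u\<bar> \<le> \<epsilon> * (u\<^sup>2 * K u) + C * (u ^ 4 * K u)"
      by (simp add: algebra_simps power4_eq_xxxx power2_eq_square)
  qed (intro continuous_intros K continuous_on_compose2[OF cp] subset_UNIV)+
  also have "cint (\<lambda>u. \<epsilon> * (u\<^sup>2 * K u) + C * (u ^ 4 * K u)) =
      \<epsilon> * cint (\<lambda>u. u\<^sup>2 * K u) + C * cint (\<lambda>u. u ^ 4 * K u)"
    by (subst cint_add) (auto intro!: continuous_intros K)
  also have "cint ?T = p y + cint (\<lambda>u. u\<^sup>2 * K u) / 2 * p2 y"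
  proof -
    have "cint ?T = cint (\<lambda>u. p y * K u) + cint (\<lambda>u. p1 y * (u * K u) + p2 y / 2 * (u\<^sup>2 * K u))"
      by (intro cint_add continuous_intros K)
    also have "cint (\<lambda>u. p1 y * (u * K u) + p2 y / 2 * (u\<^sup>2 * K u)) =
        cint (\<lambda>u. p1 y * (u * K u)) + cint (\<lambda>u. p2 y / 2 * (u\<^sup>2 * K u))"
      by (intro cint_add continuous_intros K)
    finally show ?thesis by (simp only: set_integral_mult_right odd K(4)) simp
  qed
  finally show ?thesis .
qed

text \<open>After \<open>G (y - x) = G (x - y)\<close>, writing \<open>f x\<close> as
  \<open>f (y + (x - y))\<close> exhibits the integrand as a translate of the periodic function
  \<open>G u * f (y + u)\<close>.\<close>

lemma cint_convolution:
  assumes G: "continuous_on UNIV G" "periodic_2pi G" "\<And>u. G (- u) = G u"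
    and f: "continuous_on UNIV f" "periodic_2pi f"
  shows "cint (\<lambda>x. f x * G (y - x)) = cint (\<lambda>u. G u * f (y + u))"
proof -
  have "cint (\<lambda>x. G (x - y) * f (y + (x - y))) = cint (\<lambda>u. G u * f (y + u))"
  proof (rule cint_translate)
    show "continuous_on UNIV (\<lambda>u. G u * f (y + u))"
      by (intro continuous_intros G continuous_on_compose2[OF f(1)] subset_UNIV)
    show "periodic_2pi (\<lambda>u. G u * f (y + u))"
      using G(2) f(2) by (auto simp: periodic_2pi_def add.assoc[symmetric])
  qed
  moreover have "G (x - y) = G (y - x)" for x
    using G(3)[of "x - y"] by simp
  ultimately show ?thesis by (simp add: mult.commute)
qed

section \<open>Variance of a symmetric double sum\<close>

lemma abs_mult_bound: "\<bar>a\<bar> \<le> A \<Longrightarrow> \<bar>b\<bar> \<le> C \<Longrightarrow> \<bar>a * b\<bar> \<le> A * C" for a b A C :: real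
  unfolding abs_mult by (rule mult_mono) auto

lemma integral_sum_sum:
  fixes f :: "'b \<Rightarrow> 'c \<Rightarrow> 'a \<Rightarrow> real"
  assumes "\<And>i j. i \<in> I \<Longrightarrow> j \<in> J \<Longrightarrow> integrable M (f i j)"
  shows "integrable M (\<lambda>\<omega>. \<Sum>i\<in>I. \<Sum>j\<in>J. f i j \<omega>)"
    and "(\<integral>\<omega>. (\<Sum>i\<in>I. \<Sum>j\<in>J. f i j \<omega>) \<partial>M) = (\<Sum>i\<in>I. \<Sum>j\<in>J. \<integral>\<omega>. f i j \<omega> \<partial>M)"
proof -
  have *: "integrable M (\<lambda>\<omega>. \<Sum>j\<in>J. f i j \<omega>)"
    "(\<integral>\<omega>. (\<Sum>j\<in>J. f i j \<omega>) \<partial>M) = (\<Sum>j\<in>J. \<integral>\<omega>. f i j \<omega> \<partial>M)" if "i \<in> I" for i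
    using assms that by (auto intro!: Bochner_Integration.integral_sum)
  show "integrable M (\<lambda>\<omega>. \<Sum>i\<in>I. \<Sum>j\<in>J. f i j \<omega>)"
    by (rule Bochner_Integration.integrable_sum) (rule *)
  show "(\<integral>\<omega>. (\<Sum>i\<in>I. \<Sum>j\<in>J. f i j \<omega>) \<partial>M) = (\<Sum>i\<in>I. \<Sum>j\<in>J. \<integral>\<omega>. f i j \<omega> \<partial>M)"
    by (subst Bochner_Integration.integral_sum) (auto intro!: sum.cong simp: *)
qed

section \<open>Expectations of products over an independent sample\<close>

locale iid_sample = prob_space M for M :: "'a measure" +
  fixes X :: "nat \<Rightarrow> 'a \<Rightarrow> real" and \<mu> :: "real measure"
  assumes indep: "indep_vars (\<lambda>_. borel) X {1..}"
    and X_distr: "\<And>i. i \<ge> 1 \<Longrightarrow> distr M borel (X i) = \<mu>"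
begin

lemma X_measurable: "i \<ge> 1 \<Longrightarrow> X i \<in> borel_measurable M"
  using indep by (auto simp: indep_vars_def)

lemma sets_\<mu> [measurable_cong, simp]: "sets \<mu> = sets borel"
  using X_distr[of 1] by (metis le_refl sets_distr)

lemma space_\<mu> [simp]: "space \<mu> = UNIV"
  using sets_eq_imp_space_eq[OF sets_\<mu>] by simp

lemma prob_space_\<mu>: "prob_space \<mu>"
  using prob_space_distr[OF X_measurable, of 1] X_distr[of 1] by simp

sublocale \<mu>: prob_space \<mu>
  by (rule prob_space_\<mu>)

lemma measure_\<mu>_UNIV [simp]: "measure \<mu> UNIV = 1"
  using \<mu>.prob_space by simp

lemma integrable_bounded:
  assumes "F \<in> borel_measurable M" "\<And>\<omega>. \<bar>F \<omega>\<bar> \<le> (C :: real)"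
  shows "integrable M F"
  by (rule integrable_const_bound[of _ C]) (use assms in auto)

lemma integrable_bounded_\<mu>:
  assumes "F \<in> borel_measurable borel" "\<And>\<omega>. \<bar>F \<omega>\<bar> \<le> (C :: real)"
  shows "integrable \<mu> F"
  by (rule \<mu>.integrable_const_bound[of _ C]) (use assms in auto)

lemma expectation_single:
  fixes \<phi> :: "real \<Rightarrow> real"
  assumes "i \<ge> 1" "\<phi> \<in> borel_measurable borel"
  shows "expectation (\<lambda>\<omega>. \<phi> (X i \<omega>)) = (\<integral>x. \<phi> x \<partial>\<mu>)"
  unfolding X_distr[OF assms(1), symmetric]
  by (subst integral_distr) (use X_measurable[OF assms(1)] assms(2) in auto)

text \<open>The joint law of the sample is a product measure, so coordinate \<open>i\<close> can be
  integrated first with the others frozen. This takes the place of conditioning on the other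
  variables.\<close>

lemma expectation_eq_0I:
  fixes F :: "(nat \<Rightarrow> real) \<Rightarrow> real"
  assumes i: "i \<in> {1..n}" and F: "F \<in> borel_measurable (Pi\<^sub>M {1..n} (\<lambda>_. borel))"
    and bounded: "\<And>x. \<bar>F x\<bar> \<le> C"
    and zero: "\<And>x. (\<integral>y. F (x(i := y)) \<partial>\<mu>) = 0"
  shows "expectation (\<lambda>\<omega>. F (\<lambda>j\<in>{1..n}. X j \<omega>)) = 0"
proof -
  interpret P: product_prob_space "\<lambda>_ :: nat. \<mu>" by unfold_locales
  interpret PF: finite_product_prob_space "\<lambda>_ :: nat. \<mu>" "{1..n}" by unfold_locales simp
  have iv: "indep_vars (\<lambda>_. borel) X {1..n}"
    using indep by (rule indep_vars_subset) auto
  have rv: "random_variable borel (X j)" if "j \<in> {1..n}" for j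
    using X_measurable that by auto
  have "distr M (\<Pi>\<^sub>M j\<in>{1..n}. borel) (\<lambda>\<omega>. \<lambda>j\<in>{1..n}. X j \<omega>) =
      (\<Pi>\<^sub>M j\<in>{1..n}. distr M borel (X j))"
    using indep_vars_iff_distr_eq_PiM'[where I = "{1..n}" and M' = "\<lambda>_. borel" and X = X] i iv rv by auto
  also have "\<dots> = (\<Pi>\<^sub>M j\<in>{1..n}. \<mu>)"
    by (intro PiM_cong) (auto simp: X_distr)
  finally have D: "distr M (\<Pi>\<^sub>M j\<in>{1..n}. borel) (\<lambda>\<omega>. \<lambda>j\<in>{1..n}. X j \<omega>) = (\<Pi>\<^sub>M j\<in>{1..n}. \<mu>)" .
  have "expectation (\<lambda>\<omega>. F (\<lambda>j\<in>{1..n}. X j \<omega>)) = (\<integral>x. F x \<partial>(\<Pi>\<^sub>M j\<in>{1..n}. \<mu>))"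
    unfolding D[symmetric]
    by (subst integral_distr) (use rv F in \<open>auto intro!: measurable_restrict\<close>)
  also have "\<dots> = (\<integral>x. F x \<partial>Pi\<^sub>M (insert i ({1..n} - {i})) (\<lambda>_. \<mu>))"
    using i by (simp add: insert_absorb)
  also have "\<dots> = (\<integral>x. (\<integral>y. F (x(i := y)) \<partial>\<mu>) \<partial>Pi\<^sub>M ({1..n} - {i}) (\<lambda>_. \<mu>))"
  proof (rule P.product_integral_insert)
    have "F \<in> borel_measurable (\<Pi>\<^sub>M j\<in>{1..n}. \<mu>)"
      using F by (simp cong: measurable_cong_sets sets_PiM_cong)
    then have "integrable (\<Pi>\<^sub>M j\<in>{1..n}. \<mu>) F"
      by (intro PF.integrable_const_bound[of _ C]) (use bounded in auto)
    then show "integrable (Pi\<^sub>M (insert i ({1..n} - {i})) (\<lambda>_. \<mu>)) F"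
      using i by (simp add: insert_absorb)
  qed auto
  finally show ?thesis by (simp add: zero)
qed

text \<open>\<open>X i\<close> occurs only in the first argument of \<open>u\<close>. The indices
  \<open>j\<close>, \<open>k\<close>, \<open>l\<close> may coincide with one another, so one
  statement covers all the vanishing correlations below.\<close>

lemma expectation_product_eq_0:
  fixes u \<phi> :: "real \<Rightarrow> real \<Rightarrow> real"
  assumes i: "i \<ge> 1" "j \<ge> 1" "k \<ge> 1" "l \<ge> 1" "i \<noteq> j" "i \<noteq> k" "i \<noteq> l"
    and u [measurable]: "(\<lambda>(x, y). u x y) \<in> borel_measurable (borel \<Otimes>\<^sub>M borel)" and ub: "\<And>x y. \<bar>u x y\<bar> \<le> C"
    and \<phi> [measurable]: "(\<lambda>(x, y). \<phi> x y) \<in> borel_measurable (borel \<Otimes>\<^sub>M borel)" and \<phi>b: "\<And>x y. \<bar>\<phi> x y\<bar> \<le> D"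
    and zero: "\<And>z. (\<integral>y. u y z \<partial>\<mu>) = 0"
  shows "expectation (\<lambda>\<omega>. u (X i \<omega>) (X j \<omega>) * \<phi> (X k \<omega>) (X l \<omega>)) = 0"
proof -
  \<comment> \<open>Any common upper bound of the four indices serves.\<close>
  define n where "n = i + j + k + l"
  have n [simp]: "i \<in> {1..n}" "j \<in> {1..n}" "k \<in> {1..n}" "l \<in> {1..n}" using i by (auto simp: n_def)
  have "expectation (\<lambda>\<omega>. (\<lambda>x. u (x i) (x j) * \<phi> (x k) (x l)) (\<lambda>j\<in>{1..n}. X j \<omega>)) = 0"
  proof (rule expectation_eq_0I[OF n(1), where C = "C * D"])
    have "(\<lambda>x. (\<lambda>(x, y). u x y) (x i, x j) * (\<lambda>(x, y). \<phi> x y) (x k, x l))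
        \<in> borel_measurable (Pi\<^sub>M {1..n} (\<lambda>_. borel))"
      by (intro borel_measurable_times measurable_compose[OF _ u] measurable_compose[OF _ \<phi>]
          measurable_Pair measurable_component_singleton n)
    then show "(\<lambda>x. u (x i) (x j) * \<phi> (x k) (x l)) \<in> borel_measurable (Pi\<^sub>M {1..n} (\<lambda>_. borel))"
      by simp
    show "\<bar>u (x i) (x j) * \<phi> (x k) (x l)\<bar> \<le> C * D" for x
      by (intro abs_mult_bound ub \<phi>b)
    show "(\<integral>y. u ((x(i := y)) i) ((x(i := y)) j) * \<phi> ((x(i := y)) k) ((x(i := y)) l) \<partial>\<mu>) = 0" for x
      using i zero by simp
  qed
  then show ?thesis using n by simp
qed

end

text \<open>Hoeffding's decomposition \<open>G x y = H x y + w x + w y + e\<close>: as \<open>H\<close> integrates to zero in each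
  variable, products of \<open>H\<close> terms with different index pairs are uncorrelated.\<close>

locale symmetric_statistic = iid_sample +
  fixes G :: "real \<Rightarrow> real \<Rightarrow> real" and B :: real
  assumes G_measurable: "(\<lambda>(x, y). G x y) \<in> borel_measurable (borel \<Otimes>\<^sub>M borel)"
    and G_bounded: "\<And>x y. \<bar>G x y\<bar> \<le> B"
    and G_sym: "\<And>x y. G x y = G y x"
begin

definition g where "g x = (\<integral>y. G x y \<partial>\<mu>)"
definition e where "e = (\<integral>x. g x \<partial>\<mu>)"
definition w where "w x = g x - e"
definition H where "H x y = G x y - g x - g y + e"
text \<open>\<open>\<gamma>\<close> and \<open>q\<close> are the conditional and the total second
  moment of \<open>G\<close> at two independent sample points; \<open>v\<close> is the variance of
  the projection \<open>g\<close> at one.\<close>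

definition \<gamma> where "\<gamma> z = (\<integral>y. (G z y)\<^sup>2 \<partial>\<mu>)"
definition q where "q = (\<integral>z. \<gamma> z \<partial>\<mu>)"
definition v where "v = (\<integral>x. (g x)\<^sup>2 \<partial>\<mu>) - e\<^sup>2"

declare G_measurable [measurable]

lemma G_section_measurable [measurable]: "G x \<in> borel_measurable borel"
  using measurable_compose[OF measurable_Pair1'[of x borel borel] G_measurable] by simp

lemma g_measurable [measurable]: "g \<in> borel_measurable borel"
proof -
  have [measurable]: "(\<lambda>(x, y). G x y) \<in> borel_measurable (borel \<Otimes>\<^sub>M \<mu>)"
    using G_measurable by (simp cong: measurable_cong_sets sets_pair_measure_cong)
  show ?thesis unfolding g_def[abs_def] by measurable
qed

lemma \<gamma>_measurable [measurable]: "\<gamma> \<in> borel_measurable borel"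
proof -
  have [measurable]: "(\<lambda>(x, y). G x y) \<in> borel_measurable (borel \<Otimes>\<^sub>M \<mu>)"
    using G_measurable by (simp cong: measurable_cong_sets sets_pair_measure_cong)
  show ?thesis unfolding \<gamma>_def[abs_def] by measurable
qed

lemma g_bounded: "\<bar>g x\<bar> \<le> B"
proof -
  have "\<bar>g x\<bar> \<le> (\<integral>y. B \<partial>\<mu>)"
    unfolding g_def
    by (rule order.trans[OF integral_abs_bound integral_mono])
       (use G_bounded in \<open>auto intro!: integrable_bounded_\<mu>[of _ B]\<close>)
  then show ?thesis by (simp add: \<mu>.prob_space)
qed

lemma integrable_g: "integrable \<mu> g"
  using g_bounded by (intro integrable_bounded_\<mu>[of _ B]) auto

lemma integrable_G: "integrable \<mu> (G x)"
  using G_bounded by (intro integrable_bounded_\<mu>[of _ B]) auto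

lemma e_bounded: "\<bar>e\<bar> \<le> B"
proof -
  have "\<bar>e\<bar> \<le> (\<integral>y. B \<partial>\<mu>)"
    unfolding e_def
    by (rule order.trans[OF integral_abs_bound integral_mono])
       (use g_bounded in \<open>auto intro!: integrable_bounded_\<mu>[of _ B]\<close>)
  then show ?thesis by (simp add: \<mu>.prob_space)
qed

lemma w_measurable [measurable]: "w \<in> borel_measurable borel"
  unfolding w_def[abs_def] by measurable

lemma H_measurable [measurable]: "(\<lambda>(x, y). H x y) \<in> borel_measurable (borel \<Otimes>\<^sub>M borel)"
  unfolding H_def[abs_def] by measurable

lemma w_bounded: "\<bar>w x\<bar> \<le> 2 * B"
  using g_bounded[of x] e_bounded unfolding w_def by linarith

lemma H_bounded: "\<bar>H x y\<bar> \<le> 4 * B"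
  using g_bounded[of x] g_bounded[of y] e_bounded G_bounded[of x y] unfolding H_def by linarith

lemma H_sym: "H x y = H y x"
  by (simp add: H_def G_sym)

lemma integral_w: "(\<integral>y. w y \<partial>\<mu>) = 0"
  unfolding w_def using integrable_g by (simp add: e_def \<mu>.prob_space)

lemma integral_H: "(\<integral>y. H y z \<partial>\<mu>) = 0"
proof -
  have "(\<integral>y. H z y \<partial>\<mu>) = 0"
    unfolding H_def using integrable_g integrable_G by (simp add: \<mu>.prob_space flip: g_def e_def)
  then show ?thesis by (simp add: H_sym)
qed

lemma G_decomp: "G x y = H x y + (w x + w y + e)"
  by (simp add: H_def w_def)

lemma XX_measurable:
  assumes "i \<ge> 1" "j \<ge> 1" "(\<lambda>(x, y). \<phi> x y) \<in> borel_measurable (borel \<Otimes>\<^sub>M borel)"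
  shows "(\<lambda>\<omega>. \<phi> (X i \<omega>) (X j \<omega>) :: real) \<in> borel_measurable M"
  using measurable_compose[OF measurable_Pair[OF X_measurable X_measurable] assms(3)] assms(1,2) by simp

lemma wX_measurable: "i \<ge> 1 \<Longrightarrow> (\<lambda>\<omega>. w (X i \<omega>)) \<in> borel_measurable M"
  by (rule measurable_compose[OF X_measurable w_measurable])

lemma B_nonneg: "0 \<le> B"
  using G_bounded[of 0 0] by linarith

lemma integrable_HH:
  "i \<ge> 1 \<Longrightarrow> j \<ge> 1 \<Longrightarrow> k \<ge> 1 \<Longrightarrow> l \<ge> 1 \<Longrightarrow>
    integrable M (\<lambda>\<omega>. H (X i \<omega>) (X j \<omega>) * H (X k \<omega>) (X l \<omega>))"
  by (intro integrable_bounded[of _ "4 * B * (4 * B)"] borel_measurable_times XX_measurable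
      H_measurable abs_mult_bound H_bounded)

lemma integrable_Hw:
  "i \<ge> 1 \<Longrightarrow> j \<ge> 1 \<Longrightarrow> k \<ge> 1 \<Longrightarrow> integrable M (\<lambda>\<omega>. H (X i \<omega>) (X j \<omega>) * w (X k \<omega>))"
  by (intro integrable_bounded[of _ "4 * B * (2 * B)"] borel_measurable_times XX_measurable wX_measurable
      H_measurable abs_mult_bound H_bounded w_bounded)

lemma integrable_ww:
  "i \<ge> 1 \<Longrightarrow> k \<ge> 1 \<Longrightarrow> integrable M (\<lambda>\<omega>. w (X i \<omega>) * w (X k \<omega>))"
  by (intro integrable_bounded[of _ "2 * B * (2 * B)"] borel_measurable_times wX_measurable
      abs_mult_bound w_bounded)

lemma integrable_H: "i \<ge> 1 \<Longrightarrow> j \<ge> 1 \<Longrightarrow> integrable M (\<lambda>\<omega>. H (X i \<omega>) (X j \<omega>))"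
  by (rule integrable_bounded[of _ "4 * B"]) (auto intro!: XX_measurable H_measurable H_bounded)

lemma integrable_w: "i \<ge> 1 \<Longrightarrow> integrable M (\<lambda>\<omega>. w (X i \<omega>))"
  by (rule integrable_bounded[of _ "2 * B"]) (auto intro!: wX_measurable w_bounded)

text \<open>By symmetry of \<open>H\<close>, an index missing from \<open>{k, l}\<close> can be
  taken as the first argument, over which \<open>H\<close> integrates to 0.\<close>

lemma expectation_HH_eq_0:
  assumes "i \<ge> 1" "j \<ge> 1" "k \<ge> 1" "l \<ge> 1" "i \<noteq> j" "i \<notin> {k, l} \<or> j \<notin> {k, l}"
  shows "expectation (\<lambda>\<omega>. H (X i \<omega>) (X j \<omega>) * H (X k \<omega>) (X l \<omega>)) = 0"
proof -
  have *: "expectation (\<lambda>\<omega>. H (X i \<omega>) (X j \<omega>) * H (X k \<omega>) (X l \<omega>)) = 0"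
    if "i \<ge> 1" "j \<ge> 1" "i \<noteq> j" "i \<notin> {k, l}" for i j
    using assms that
    by (intro expectation_product_eq_0[where C = "4 * B" and D = "4 * B"] H_bounded integral_H H_measurable) auto
  show ?thesis using *[of i j] *[of j i] assms H_sym[of "X i _"] by auto
qed

text \<open>\<open>k\<close> differs from at least one of \<open>i\<close> and \<open>j\<close>;
  integrating out that one gives 0.\<close>

lemma expectation_Hw_eq_0:
  assumes "i \<ge> 1" "j \<ge> 1" "k \<ge> 1" "i \<noteq> j"
  shows "expectation (\<lambda>\<omega>. H (X i \<omega>) (X j \<omega>) * w (X k \<omega>)) = 0"
proof -
  have *: "expectation (\<lambda>\<omega>. H (X i \<omega>) (X j \<omega>) * w (X k \<omega>)) = 0"
    if "i \<ge> 1" "j \<ge> 1" "i \<noteq> j" "i \<noteq> k" for i j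
    using assms that
    by (intro expectation_product_eq_0[where C = "4 * B" and D = "2 * B" and \<phi> = "\<lambda>x y. w x" and l = k]
        H_bounded w_bounded integral_H H_measurable) auto
  show ?thesis using *[of i j] *[of j i] assms H_sym[of "X i _"] by (cases "i = k") auto
qed

lemma expectation_H:
  assumes "i \<ge> 1" "j \<ge> 1" "i \<noteq> j"
  shows "expectation (\<lambda>\<omega>. H (X i \<omega>) (X j \<omega>)) = 0"
  using expectation_product_eq_0[OF assms(1,2,2,2,3,3,3) H_measurable H_bounded, of "\<lambda>x y. 1" 1]
  by (simp add: integral_H)

lemma expectation_w: "i \<ge> 1 \<Longrightarrow> expectation (\<lambda>\<omega>. w (X i \<omega>)) = 0"
  by (simp add: expectation_single integral_w)

lemma expectation_ww:
  assumes "i \<ge> 1" "k \<ge> 1"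
  shows "expectation (\<lambda>\<omega>. w (X i \<omega>) * w (X k \<omega>)) = (if i = k then v else 0)"
proof (cases "i = k")
  case True
  have "expectation (\<lambda>\<omega>. (w (X i \<omega>))\<^sup>2) = (\<integral>x. (w x)\<^sup>2 \<partial>\<mu>)"
    using assms by (intro expectation_single) auto
  also have "\<dots> = (\<integral>x. (g x)\<^sup>2 - 2 * e * g x + e\<^sup>2 \<partial>\<mu>)"
    by (simp add: w_def power2_eq_square algebra_simps)
  also have "\<dots> = (\<integral>x. (g x)\<^sup>2 \<partial>\<mu>) - 2 * e * e + e\<^sup>2"
  proof -
    have "integrable \<mu> (\<lambda>x. (g x)\<^sup>2)"
      using g_bounded by (intro integrable_bounded_\<mu>[of _ "B\<^sup>2"]) (auto simp: power2_le_iff_abs_le B_nonneg)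
    then show ?thesis using integrable_g by (simp add: \<mu>.prob_space flip: e_def)
  qed
  finally show ?thesis using True by (simp add: v_def power2_eq_square)
next
  case False
  have "expectation (\<lambda>\<omega>. (\<lambda>x y. w x) (X i \<omega>) (X k \<omega>) * (\<lambda>x y. w x) (X k \<omega>) (X k \<omega>)) = 0"
    using assms False
    by (intro expectation_product_eq_0[where C = "2 * B" and D = "2 * B"]) (auto simp: w_bounded integral_w)
  then show ?thesis using False by simp
qed

text \<open>Subtracting the section mean \<open>\<gamma> y\<close> centres the square in its first
  argument, so \<open>expectation_product_eq_0\<close> applies and leaves the expectation of
  \<open>\<gamma>\<close>.\<close>

lemma expectation_G2:
  assumes "i \<ge> 1" "j \<ge> 1" "i \<noteq> j"
  shows "expectation (\<lambda>\<omega>. (G (X i \<omega>) (X j \<omega>))\<^sup>2) = q"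
proof -
  have G2b: "(G x y)\<^sup>2 \<le> B\<^sup>2" for x y
    using G_bounded B_nonneg by (simp add: power2_le_iff_abs_le)
  have iG2: "integrable \<mu> (\<lambda>y. (G z y)\<^sup>2)" for z
    using G2b by (intro integrable_bounded_\<mu>[of _ "B\<^sup>2"]) auto
  have \<gamma>b: "\<bar>\<gamma> z\<bar> \<le> B\<^sup>2" for z
  proof -
    have "\<gamma> z \<le> (\<integral>y. B\<^sup>2 \<partial>\<mu>)" unfolding \<gamma>_def
      by (rule integral_mono) (use iG2 G2b in auto)
    then show ?thesis by (simp add: \<mu>.prob_space \<gamma>_def)
  qed
  have "expectation (\<lambda>\<omega>. (\<lambda>x y. (G x y)\<^sup>2 - \<gamma> y) (X i \<omega>) (X j \<omega>) * (\<lambda>x y. 1) (X j \<omega>) (X j \<omega>)) = 0"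
  proof (rule expectation_product_eq_0[where C = "2 * B\<^sup>2" and D = 1])
    show "\<bar>(G x y)\<^sup>2 - \<gamma> y\<bar> \<le> 2 * B\<^sup>2" for x y
      using G2b[of x y] \<gamma>b[of y] zero_le_power2[of "G x y"] by linarith
    show "(\<integral>y. (G y z)\<^sup>2 - \<gamma> z \<partial>\<mu>) = 0" for z
      using iG2[of z] by (simp add: G_sym[of _ z] \<mu>.prob_space flip: \<gamma>_def)
  qed (use assms in auto)
  then have "expectation (\<lambda>\<omega>. (G (X i \<omega>) (X j \<omega>))\<^sup>2 - \<gamma> (X j \<omega>)) = 0" by simp
  moreover have "integrable M (\<lambda>\<omega>. (G (X i \<omega>) (X j \<omega>))\<^sup>2)"
    using assms G2b by (intro integrable_bounded[of _ "B\<^sup>2"])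
      (auto intro!: borel_measurable_power XX_measurable G_measurable)
  moreover have "integrable M (\<lambda>\<omega>. \<gamma> (X j \<omega>))"
    using assms \<gamma>b by (intro integrable_bounded[of _ "B\<^sup>2"])
      (auto intro!: measurable_compose[OF X_measurable \<gamma>_measurable])
  ultimately have "expectation (\<lambda>\<omega>. (G (X i \<omega>) (X j \<omega>))\<^sup>2) = expectation (\<lambda>\<omega>. \<gamma> (X j \<omega>))"
    by simp
  also have "\<dots> = q"
    using expectation_single[OF assms(2) \<gamma>_measurable] by (simp add: q_def)
  finally show ?thesis .
qed

text \<open>The parts of the decomposition are orthogonal, so \<open>q\<close> is the sum of the
  second moment of \<open>H\<close>, twice \<open>v\<close>, and \<open>e\<^sup>2\<close>.\<close>

lemma expectation_H2:
  assumes "i \<ge> 1" "j \<ge> 1" "i \<noteq> j"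
  shows "expectation (\<lambda>\<omega>. H (X i \<omega>) (X j \<omega>) * H (X i \<omega>) (X j \<omega>)) = q - e\<^sup>2 - 2 * v"
proof -
  let ?H = "\<lambda>\<omega>. H (X i \<omega>) (X j \<omega>)" and ?w = "\<lambda>i \<omega>. w (X i \<omega>)"
  have "q = expectation (\<lambda>\<omega>. (?H \<omega> + (?w i \<omega> + ?w j \<omega> + e))\<^sup>2)"
    using expectation_G2[OF assms] by (simp add: G_decomp[symmetric])
  also have "\<dots> = expectation (\<lambda>\<omega>. ?H \<omega> * ?H \<omega> + 2 * (?H \<omega> * ?w i \<omega>) + 2 * (?H \<omega> * ?w j \<omega>) + 2 * e * ?H \<omega>
      + ?w i \<omega> * ?w i \<omega> + ?w j \<omega> * ?w j \<omega> + 2 * (?w i \<omega> * ?w j \<omega>) + 2 * e * ?w i \<omega> + 2 * e * ?w j \<omega> + e\<^sup>2)"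
    by (intro Bochner_Integration.integral_cong) (auto simp: power2_eq_square algebra_simps)
  also have "\<dots> = expectation (\<lambda>\<omega>. ?H \<omega> * ?H \<omega>) + 2 * v + e\<^sup>2"
    using assms
    by (simp add: integrable_HH integrable_Hw integrable_H integrable_ww integrable_w expectation_ww
        expectation_w expectation_H expectation_Hw_eq_0 prob_space)
  finally show ?thesis by simp
qed

section \<open>Mean and variance of the off-diagonal double sum\<close>

definition pairs :: "nat \<Rightarrow> (nat \<times> nat) set" where
  "pairs n = (SIGMA i:{1..n}. {1..n} - {i})"

lemma finite_pairs [simp]: "finite (pairs n)"
  by (auto simp: pairs_def)

lemma card_pairs: "real (card (pairs n)) = real n * (real n - 1)"
proof -
  have "card (pairs n) = (\<Sum>i\<in>{1..n}. card ({1..n} - {i}))"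
    unfolding pairs_def by (rule card_SigmaI) auto
  also have "\<dots> = n * (n - 1)" by simp
  finally show ?thesis by (cases n) (auto simp: algebra_simps)
qed

lemma pairsD: "p \<in> pairs n \<Longrightarrow> fst p \<ge> 1 \<and> snd p \<ge> 1 \<and> fst p \<noteq> snd p"
  by (auto simp: pairs_def)

lemma sum_pairs_fst: "(\<Sum>p\<in>pairs n. h (fst p)) = (real n - 1) * (\<Sum>i=1..n. h i)" for h :: "nat \<Rightarrow> real"
proof -
  have "(\<Sum>p\<in>pairs n. h (fst p)) = (\<Sum>i\<in>{1..n}. \<Sum>j\<in>{1..n} - {i}. h i)"
    unfolding pairs_def by (subst sum.Sigma) (auto simp: case_prod_unfold)
  also have "\<dots> = (\<Sum>i\<in>{1..n}. (real n - 1) * h i)"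
    by (intro sum.cong) (auto simp: of_nat_diff)
  finally show ?thesis by (simp add: sum_distrib_left)
qed

lemma sum_pairs_snd: "(\<Sum>p\<in>pairs n. h (snd p)) = (real n - 1) * (\<Sum>i=1..n. h i)" for h :: "nat \<Rightarrow> real"
proof -
  have "(\<Sum>p\<in>pairs n. h (snd p)) = (\<Sum>p\<in>pairs n. h (fst p))"
    by (rule sum.reindex_bij_witness[of _ prod.swap prod.swap]) (auto simp: pairs_def)
  then show ?thesis by (simp add: sum_pairs_fst)
qed

text \<open>The double sum without its diagonal. For the estimator the diagonal is a constant; it
  returns in \<open>psi_hat_moments\<close>.\<close>

definition T :: "nat \<Rightarrow> 'a \<Rightarrow> real" where
  "T n \<omega> = (\<Sum>p\<in>pairs n. G (X (fst p) \<omega>) (X (snd p) \<omega>))"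

text \<open>Each index stands in \<open>n - 1\<close> pairs as first and in \<open>n - 1\<close>
  pairs as second entry, hence the factor \<open>2 * (real n - 1)\<close>.\<close>

lemma T_decomp:
  "T n \<omega> = (\<Sum>p\<in>pairs n. H (X (fst p) \<omega>) (X (snd p) \<omega>)) + 2 * (real n - 1) * (\<Sum>i=1..n. w (X i \<omega>))
    + real n * (real n - 1) * e"
proof -
  have "T n \<omega> = (\<Sum>p\<in>pairs n. H (X (fst p) \<omega>) (X (snd p) \<omega>) + (w (X (fst p) \<omega>) + w (X (snd p) \<omega>) + e))"
    unfolding T_def by (intro sum.cong refl G_decomp)
  also have "\<dots> = (\<Sum>p\<in>pairs n. H (X (fst p) \<omega>) (X (snd p) \<omega>)) +
      ((real n - 1) * (\<Sum>i=1..n. w (X i \<omega>)) + (real n - 1) * (\<Sum>i=1..n. w (X i \<omega>)) + real (card (pairs n)) * e)"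
    by (simp only: sum.distrib sum_pairs_fst[of "\<lambda>i. w (X i \<omega>)"] sum_pairs_snd[of "\<lambda>i. w (X i \<omega>)"]
        sum_constant)
  finally show ?thesis
    by (simp add: card_pairs algebra_simps)
qed

lemma T_measurable: "T n \<in> borel_measurable M"
  unfolding T_def[abs_def]
proof (rule borel_measurable_sum)
  fix p assume "p \<in> pairs n"
  then show "(\<lambda>\<omega>. G (X (fst p) \<omega>) (X (snd p) \<omega>)) \<in> borel_measurable M"
    using pairsD[of p n] by (intro XX_measurable G_measurable) auto
qed

lemma expectation_T: "expectation (T n) = real n * (real n - 1) * e"
proof -
  have h: "integrable M (\<lambda>\<omega>. H (X (fst p) \<omega>) (X (snd p) \<omega>))" "expectation (\<lambda>\<omega>. H (X (fst p) \<omega>) (X (snd p) \<omega>)) = 0"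
    if "p \<in> pairs n" for p
    using pairsD[OF that] by (auto intro: integrable_H expectation_H)
  let ?U = "\<lambda>\<omega>. \<Sum>p\<in>pairs n. H (X (fst p) \<omega>) (X (snd p) \<omega>)" and ?W = "\<lambda>\<omega>. \<Sum>i=1..n. w (X i \<omega>)"
  have "integrable M ?U" "integrable M ?W"
    by (auto intro!: Bochner_Integration.integrable_sum h integrable_w)
  moreover have "expectation ?U = 0" "expectation ?W = 0"
    using h by (auto simp: Bochner_Integration.integral_sum integrable_w expectation_w)
  ultimately have "expectation (\<lambda>\<omega>. ?U \<omega> + 2 * (real n - 1) * ?W \<omega> + real n * (real n - 1) * e) =
      real n * (real n - 1) * e"
    by (simp add: prob_space)
  then show ?thesis
    unfolding T_decomp[abs_def] .
qed

text \<open>Mixed products vanish. An ordered pair correlates only with itself and its swap, which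
  gives the factor 2 in front of \<open>n (n - 1)\<close>; each \<open>w\<close> carries the weight
  \<open>2 (n - 1)\<close>, which gives \<open>4 n (n - 1)^2 v\<close>.\<close>

lemma variance_T:
  "variance (T n) = 2 * real n * (real n - 1) * (q - e\<^sup>2 - 2 * v) + 4 * real n * (real n - 1)\<^sup>2 * v"
proof -
  let ?h = "\<lambda>p \<omega>. H (X (fst p) \<omega>) (X (snd p) \<omega>)" and ?w = "\<lambda>i \<omega>. w (X i \<omega>)" and ?\<eta> = "q - e\<^sup>2 - 2 * v"
  have hh: "integrable M (\<lambda>\<omega>. ?h p \<omega> * ?h p' \<omega>)" if "p \<in> pairs n" "p' \<in> pairs n" for p p'
    using pairsD[OF that(1)] pairsD[OF that(2)] by (blast intro: integrable_HH)
  have hw: "integrable M (\<lambda>\<omega>. ?h p \<omega> * ?w i \<omega>)" "expectation (\<lambda>\<omega>. ?h p \<omega> * ?w i \<omega>) = 0"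
    if "p \<in> pairs n" "i \<in> {1..n}" for p i
    using pairsD[OF that(1)] that(2) by (simp_all add: integrable_Hw expectation_Hw_eq_0)
  have Ehh: "expectation (\<lambda>\<omega>. ?h p \<omega> * ?h p' \<omega>) = (if p' \<in> {p, prod.swap p} then ?\<eta> else 0)"
    if p: "p \<in> pairs n" "p' \<in> pairs n" for p p'
  proof (cases "p' \<in> {p, prod.swap p}")
    case True
    then have "?h p' \<omega> = ?h p \<omega>" for \<omega>
      using H_sym[of "X (fst p) \<omega>" "X (snd p) \<omega>"] by auto
    then show ?thesis using True expectation_H2[of "fst p" "snd p"] pairsD[OF p(1)] by simp
  next
    case False
    obtain i j k l where ij: "p = (i, j)" "p' = (k, l)" by (cases p, cases p')
    have "fst p \<notin> {fst p', snd p'} \<or> snd p \<notin> {fst p', snd p'}"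
      using False pairsD[OF p(1)] unfolding ij by auto
    then show ?thesis
      using False pairsD[OF p(1)] pairsD[OF p(2)] expectation_HH_eq_0[of "fst p" "snd p" "fst p'" "snd p'"]
      by simp
  qed
  have row: "(\<Sum>p'\<in>pairs n. if p' \<in> {p, prod.swap p} then ?\<eta> else 0) = 2 * ?\<eta>" if p: "p \<in> pairs n" for p
  proof -
    have "prod.swap p \<in> pairs n" "p \<noteq> prod.swap p" using p by (auto simp: pairs_def)
    then have "(\<Sum>p'\<in>pairs n. if p' \<in> {p, prod.swap p} then ?\<eta> else 0) = (\<Sum>p'\<in>{p, prod.swap p}. ?\<eta>)"
      using p by (intro sum.mono_neutral_cong_right) auto
    then show ?thesis using \<open>p \<noteq> prod.swap p\<close> by simp
  qed
  have hh_sum: "integrable M (\<lambda>\<omega>. \<Sum>p\<in>pairs n. \<Sum>p'\<in>pairs n. ?h p \<omega> * ?h p' \<omega>)"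
    "expectation (\<lambda>\<omega>. \<Sum>p\<in>pairs n. \<Sum>p'\<in>pairs n. ?h p \<omega> * ?h p' \<omega>) =
      (\<Sum>p\<in>pairs n. \<Sum>p'\<in>pairs n. expectation (\<lambda>\<omega>. ?h p \<omega> * ?h p' \<omega>))"
    by (rule integral_sum_sum, rule hh; assumption)+
  have hw_sum: "integrable M (\<lambda>\<omega>. \<Sum>p\<in>pairs n. \<Sum>i\<in>{1..n}. ?h p \<omega> * ?w i \<omega>)"
    "expectation (\<lambda>\<omega>. \<Sum>p\<in>pairs n. \<Sum>i\<in>{1..n}. ?h p \<omega> * ?w i \<omega>) =
      (\<Sum>p\<in>pairs n. \<Sum>i\<in>{1..n}. expectation (\<lambda>\<omega>. ?h p \<omega> * ?w i \<omega>))"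
    by (rule integral_sum_sum, rule hw(1); assumption)+
  have ww_sum: "integrable M (\<lambda>\<omega>. \<Sum>i\<in>{1..n}. \<Sum>k\<in>{1..n}. ?w i \<omega> * ?w k \<omega>)"
    "expectation (\<lambda>\<omega>. \<Sum>i\<in>{1..n}. \<Sum>k\<in>{1..n}. ?w i \<omega> * ?w k \<omega>) =
      (\<Sum>i\<in>{1..n}. \<Sum>k\<in>{1..n}. expectation (\<lambda>\<omega>. ?w i \<omega> * ?w k \<omega>))"
    by (rule integral_sum_sum, rule integrable_ww; simp)+
  have "variance (T n) = expectation (\<lambda>\<omega>. ((\<Sum>p\<in>pairs n. ?h p \<omega>) + 2 * (real n - 1) * (\<Sum>i=1..n. ?w i \<omega>))\<^sup>2)"
    unfolding expectation_T by (simp add: T_decomp)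
  also have "\<dots> = expectation (\<lambda>\<omega>. (\<Sum>p\<in>pairs n. \<Sum>p'\<in>pairs n. ?h p \<omega> * ?h p' \<omega>)
      + 4 * (real n - 1) * (\<Sum>p\<in>pairs n. \<Sum>i=1..n. ?h p \<omega> * ?w i \<omega>)
      + 4 * (real n - 1)\<^sup>2 * (\<Sum>i=1..n. \<Sum>k=1..n. ?w i \<omega> * ?w k \<omega>))"
    unfolding sum_product[symmetric]
    by (intro Bochner_Integration.integral_cong) (auto simp: power2_eq_square algebra_simps)
  also have "\<dots> = expectation (\<lambda>\<omega>. \<Sum>p\<in>pairs n. \<Sum>p'\<in>pairs n. ?h p \<omega> * ?h p' \<omega>)
      + 4 * (real n - 1) * expectation (\<lambda>\<omega>. \<Sum>p\<in>pairs n. \<Sum>i=1..n. ?h p \<omega> * ?w i \<omega>)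
      + 4 * (real n - 1)\<^sup>2 * expectation (\<lambda>\<omega>. \<Sum>i=1..n. \<Sum>k=1..n. ?w i \<omega> * ?w k \<omega>)"
    using hh_sum(1) hw_sum(1) ww_sum(1) by simp
  also have "\<dots> = (\<Sum>p\<in>pairs n. 2 * ?\<eta>) + 4 * (real n - 1)\<^sup>2 * (real n * v)"
    unfolding hh_sum(2) hw_sum(2) ww_sum(2)
    by (simp add: Ehh row hw(2) expectation_ww del: insert_iff)
  finally show ?thesis by (simp add: card_pairs algebra_simps)
qed

end

section \<open>Moments of the estimator\<close>

lemma integral_circular_density:
  assumes "circular_density f" "\<phi> \<in> borel_measurable borel"
  shows "(\<integral>x. \<phi> x \<partial>density lborel (\<lambda>x. ennreal (f x * indicator {-pi..<pi} x))) = cint (\<lambda>x. f x * \<phi> x)"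
proof -
  have f: "f \<in> borel_measurable borel" "\<And>x. 0 \<le> f x"
    using assms(1) by (auto simp: circular_density_def)
  have "(\<integral>x. \<phi> x \<partial>density lborel (\<lambda>x. ennreal (f x * indicator {-pi..<pi} x))) =
      (\<integral>x. (f x * indicator {-pi..<pi} x) *\<^sub>R \<phi> x \<partial>lborel)"
    by (rule integral_density) (use f assms(2) in auto)
  then show ?thesis by (simp add: set_lebesgue_integral_def mult_ac)
qed

text \<open>The estimator is an affine function of \<open>T\<close>, so the formulas are exact for
  every \<open>n\<close>; at \<open>n = 0\<close> both sides are 0 because division by 0 gives
  0.\<close>

lemma psi_hat_moments:
  fixes L :: "real \<Rightarrow> real \<Rightarrow> real" and r :: real and s n :: nat
  assumes f: "circular_density f" "continuous_on UNIV f"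
    and iid: "iid_sample M X (density lborel (\<lambda>x. ennreal (f x * indicator {-pi..<pi} x)))"
    and G: "continuous_on UNIV ((deriv ^^ s) (L r))" "periodic_2pi ((deriv ^^ s) (L r))"
      "\<And>u. (deriv ^^ s) (L r) (- u) = (deriv ^^ s) (L r) u"
  defines "g \<equiv> \<lambda>y. cint (\<lambda>u. (deriv ^^ s) (L r) u * f (y + u))"
    and "c \<equiv> \<lambda>y. cint (\<lambda>u. ((deriv ^^ s) (L r) u)\<^sup>2 * f (y + u))"
  defines "e \<equiv> cint (\<lambda>y. f y * g y)" and "q \<equiv> cint (\<lambda>y. f y * c y)"
  defines "v \<equiv> cint (\<lambda>y. f y * (g y)\<^sup>2) - e\<^sup>2"
  shows "psi_hat L s r X n \<in> borel_measurable M"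
    and "integrable M (\<lambda>\<omega>. (psi_hat L s r X n \<omega> - a)\<^sup>2)"
    and "prob_space.expectation M (psi_hat L s r X n) =
      (real n * (deriv ^^ s) (L r) 0 + real n * (real n - 1) * e) / (real n)\<^sup>2"
    and "prob_space.variance M (psi_hat L s r X n) =
      (2 * real n * (real n - 1) * (q - e\<^sup>2 - 2 * v) + 4 * real n * (real n - 1)\<^sup>2 * v) / (real n)^4"
proof -
  let ?G = "(deriv ^^ s) (L r)" and ?\<mu> = "density lborel (\<lambda>x. ennreal (f x * indicator {-pi..<pi} x))"
  have f': "periodic_2pi f" using f by (simp add: circular_density_def)
  interpret iid_sample M X ?\<mu> by (rule iid)
  obtain B where B: "B > 0" "\<And>x. \<bar>?G x\<bar> \<le> B"
    using continuous_periodic_bounded[OF G(1,2)] by blast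
  have Gm [measurable]: "?G \<in> borel_measurable borel"
    using G(1) by (rule borel_measurable_continuous_onI)
  interpret S: symmetric_statistic M X ?\<mu> "\<lambda>x y. ?G (x - y)" B
  proof
    show "(\<lambda>(x, y). ?G (x - y)) \<in> borel_measurable (borel \<Otimes>\<^sub>M borel)" by measurable
    show "?G (x - y) = ?G (y - x)" for x y using G(3)[of "x - y"] by simp
  qed (rule B)
  \<comment> \<open>The section mean under the sample law is a convolution; recentring at
    \<open>y\<close> turns it into the local average \<open>g\<close>.\<close>
  have g: "S.g = g"
  proof
    fix y
    have "S.g y = cint (\<lambda>x. f x * ?G (y - x))"
      unfolding S.g_def by (rule integral_circular_density[OF f(1)]) measurable
    then show "S.g y = g y"
      unfolding g_def by (simp add: cint_convolution[OF G f(2) f'])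
  qed
  have c: "S.\<gamma> = c"
  proof
    fix y
    have "S.\<gamma> y = cint (\<lambda>x. f x * (?G (y - x))\<^sup>2)"
      unfolding S.\<gamma>_def by (rule integral_circular_density[OF f(1)]) measurable
    also have "\<dots> = c y"
      unfolding c_def
      by (rule cint_convolution[OF _ _ _ f(2) f'])
         (use G(2,3) in \<open>auto simp: periodic_2pi_def intro!: continuous_intros G(1)\<close>)
    finally show "S.\<gamma> y = c y" .
  qed
  have e: "S.e = e"
    unfolding S.e_def e_def by (subst integral_circular_density[OF f(1) S.g_measurable]) (simp add: g)
  have q: "S.q = q"
    unfolding S.q_def q_def by (subst integral_circular_density[OF f(1) S.\<gamma>_measurable]) (simp add: c)
  have v: "S.v = v"
    unfolding S.v_def v_def e
    by (subst integral_circular_density[OF f(1)]) (use S.g_measurable in \<open>auto simp: g\<close>)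
  have T: "psi_hat L s r X n = (\<lambda>\<omega>. (real n * ?G 0 + S.T n \<omega>) / (real n)\<^sup>2)"
  proof
    fix \<omega>
    have "(\<Sum>j=1..n. ?G (X i \<omega> - X j \<omega>)) = ?G 0 + (\<Sum>j\<in>{1..n} - {i}. ?G (X i \<omega> - X j \<omega>))"
      if "i \<in> {1..n}" for i
      using that by (subst sum.remove[of _ i]) auto
    then have "(\<Sum>i=1..n. \<Sum>j=1..n. ?G (X i \<omega> - X j \<omega>)) =
        real n * ?G 0 + (\<Sum>i=1..n. \<Sum>j\<in>{1..n} - {i}. ?G (X i \<omega> - X j \<omega>))"
      by (simp add: sum.distrib)
    also have "(\<Sum>i=1..n. \<Sum>j\<in>{1..n} - {i}. ?G (X i \<omega> - X j \<omega>)) = S.T n \<omega>"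
      unfolding S.T_def S.pairs_def by (subst sum.Sigma) (auto simp: case_prod_unfold)
    finally show "psi_hat L s r X n \<omega> = (real n * ?G 0 + S.T n \<omega>) / (real n)\<^sup>2"
      by (simp add: psi_hat_def)
  qed
  show m: "psi_hat L s r X n \<in> borel_measurable M"
    unfolding T using S.T_measurable by measurable
  \<comment> \<open>For fixed \<open>n\<close> the estimator is bounded; this crude bound only
    serves integrability.\<close>
  have "\<bar>S.T n \<omega>\<bar> \<le> real (card (S.pairs n)) * B" for \<omega>
    unfolding S.T_def
    by (rule order.trans[OF sum_abs sum_bounded_above]) (use B in auto)
  then have bound: "\<bar>S.T n \<omega>\<bar> \<le> \<bar>real (card (S.pairs n)) * B\<bar>" for \<omega>
    by (meson abs_ge_self order.trans)
  have iT: "integrable M (S.T n)"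
    using S.T_measurable bound by (rule integrable_bounded)
  have "\<bar>psi_hat L s r X n \<omega> - a\<bar> \<le> \<bar>(real n * \<bar>?G 0\<bar> + \<bar>real (card (S.pairs n)) * B\<bar>) / (real n)\<^sup>2 + \<bar>a\<bar>\<bar>" for \<omega>
  proof -
    have "\<bar>real n * ?G 0 + S.T n \<omega>\<bar> \<le> real n * \<bar>?G 0\<bar> + \<bar>real (card (S.pairs n)) * B\<bar>"
      by (rule order.trans[OF abs_triangle_ineq add_mono]) (use bound in \<open>auto simp: abs_mult\<close>)
    then have "\<bar>psi_hat L s r X n \<omega>\<bar> \<le> (real n * \<bar>?G 0\<bar> + \<bar>real (card (S.pairs n)) * B\<bar>) / (real n)\<^sup>2"
      unfolding T abs_divide by (simp add: divide_right_mono)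
    then show ?thesis by linarith
  qed
  then have "(psi_hat L s r X n \<omega> - a)\<^sup>2 \<le>
      ((real n * \<bar>?G 0\<bar> + \<bar>real (card (S.pairs n)) * B\<bar>) / (real n)\<^sup>2 + \<bar>a\<bar>)\<^sup>2" for \<omega>
    by (simp only: abs_le_square_iff)
  then show "integrable M (\<lambda>\<omega>. (psi_hat L s r X n \<omega> - a)\<^sup>2)"
    using m by (intro integrable_bounded) auto
  show E: "expectation (psi_hat L s r X n) = (real n * ?G 0 + real n * (real n - 1) * e) / (real n)\<^sup>2"
    unfolding T using iT S.expectation_T by (simp add: prob_space e)
  have "variance (psi_hat L s r X n) = expectation (\<lambda>\<omega>. (S.T n \<omega> - expectation (S.T n))\<^sup>2 / (real n)^4)"
  proof (rule Bochner_Integration.integral_cong[OF refl])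
    fix \<omega>
    have "psi_hat L s r X n \<omega> - expectation (psi_hat L s r X n) = (S.T n \<omega> - expectation (S.T n)) / (real n)\<^sup>2"
      unfolding E by (simp add: T S.expectation_T e diff_divide_distrib add_divide_distrib)
    then show "(psi_hat L s r X n \<omega> - expectation (psi_hat L s r X n))\<^sup>2 =
        (S.T n \<omega> - expectation (S.T n))\<^sup>2 / (real n)^4"
      by (simp add: power_divide flip: power_mult)
  qed
  also have "\<dots> = variance (S.T n) / (real n)^4" by simp
  finally show "variance (psi_hat L s r X n) =
      (2 * real n * (real n - 1) * (q - e\<^sup>2 - 2 * v) + 4 * real n * (real n - 1)\<^sup>2 * v) / (real n)^4"
    by (simp only: S.variance_T q e v)
qed

section \<open>Remainder classes and continuity of averages\<close>

lemma smallo_of_eps_bound: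
  fixes r a b :: "nat \<Rightarrow> real"
  assumes bound: "\<And>\<epsilon>. \<epsilon> > 0 \<Longrightarrow> \<exists>C. \<forall>n. \<bar>r n\<bar> \<le> \<epsilon> * a n + C * b n"
    and a: "\<And>n. 0 \<le> a n" and b: "b \<in> o(a)"
  shows "r \<in> o(a)"
proof (rule landau_o.smallI)
  fix \<epsilon> :: real assume "\<epsilon> > 0"
  then obtain C where C: "\<And>n. \<bar>r n\<bar> \<le> \<epsilon> / 2 * a n + C * b n"
    using bound[of "\<epsilon> / 2"] by auto
  \<comment> \<open>\<open>C\<close> depends on \<open>\<epsilon>\<close> but not on
    \<open>n\<close>, so \<open>b\<close> is eventually small enough to offset it; adding 1 to
    \<open>\<bar>C\<bar>\<close> avoids a division by 0.\<close>
  have "\<forall>\<^sub>F n in sequentially. norm (b n) \<le> \<epsilon> / (2 * (\<bar>C\<bar> + 1)) * norm (a n)"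
    using \<open>\<epsilon> > 0\<close> by (intro landau_o.smallD[OF b]) auto
  then show "\<forall>\<^sub>F n in sequentially. norm (r n) \<le> \<epsilon> * norm (a n)"
  proof eventually_elim
    case (elim n)
    have "C * b n \<le> \<bar>C\<bar> * \<bar>b n\<bar>" by (metis abs_ge_self abs_mult)
    also have "\<dots> \<le> (\<bar>C\<bar> + 1) * (\<epsilon> / (2 * (\<bar>C\<bar> + 1)) * a n)"
      using elim a[of n] by (intro mult_mono) auto
    also have "\<dots> = \<epsilon> / 2 * a n" by (simp add: add_nonneg_pos field_simps)
    finally show ?case using C[of n] a[of n] by (simp add: field_simps)
  qed
qed

text \<open>\<open>f\<close> has total mass 1, so a bound uniform in \<open>y\<close> passes to the
  averages unchanged.\<close>

lemma cint_density_average_le: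
  assumes f: "circular_density f" "continuous_on UNIV f"
    and c: "continuous_on UNIV \<phi>" "continuous_on UNIV \<gamma>" and le: "\<And>y. \<bar>\<phi> y - \<gamma> y\<bar> \<le> (d :: real)"
  shows "\<bar>cint (\<lambda>y. f y * \<phi> y) - cint (\<lambda>y. f y * \<gamma> y)\<bar> \<le> d"
proof -
  have f': "0 \<le> f y" "cint f = 1" for y using f by (auto simp: circular_density_def)
  have "\<bar>cint (\<lambda>y. f y * \<phi> y) - cint (\<lambda>y. f y * \<gamma> y)\<bar> \<le> cint (\<lambda>y. d * f y)"
  proof (rule cint_abs_diff_le)
    fix y
    have "\<bar>f y * \<phi> y - f y * \<gamma> y\<bar> = f y * \<bar>\<phi> y - \<gamma> y\<bar>"
      using f'(1)[of y] abs_mult[of "f y" "\<phi> y - \<gamma> y"] by (simp add: algebra_simps)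
    then show "\<bar>f y * \<phi> y - f y * \<gamma> y\<bar> \<le> d * f y"
      using mult_left_mono[OF le f'(1)] by (simp add: mult.commute)
  qed (intro continuous_intros f c)+
  then show ?thesis using f'(2) by simp
qed

lemma cint_eq_integral:
  assumes "continuous_on {-pi..pi} \<phi>"
  shows "cint \<phi> = integral {-pi..pi} \<phi>"
proof -
  have "cint \<phi> = (LBINT x=ereal (-pi)..ereal pi. \<phi> x)"
    by (subst interval_integral_Ico) auto
  also have "\<dots> = (LBINT x:{-pi..pi}. \<phi> x)"
    by (subst interval_integral_Icc) auto
  also have "\<dots> = integral {-pi..pi} \<phi>"
    by (intro set_borel_integral_eq_integral borel_integrable_atLeastAtMost' assms)
  finally show ?thesis .
qed

text \<open>Continuity in the parameter comes from the gauge integral over a compact box, which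
  agrees with \<open>cint\<close> on continuous integrands. It makes these averages admissible
  integrands in the \<open>cint\<close> rules.\<close>

lemma local_average_continuous:
  assumes "continuous_on UNIV Q" "continuous_on UNIV p"
  shows "continuous_on UNIV (\<lambda>y. cint (\<lambda>u. Q u * p (y + u)))"
proof -
  have "continuous_on UNIV (\<lambda>y. integral (cbox (-pi) pi) (\<lambda>u. Q u * p (y + u)))"
    by (rule integral_continuous_on_param) (auto simp: case_prod_unfold intro!: continuous_intros
      continuous_on_compose2[OF assms(1)] continuous_on_compose2[OF assms(2)])
  moreover have "cint (\<lambda>u. Q u * p (y + u)) = integral (cbox (-pi) pi) (\<lambda>u. Q u * p (y + u))" for y
    by (subst cint_eq_integral) (auto intro!: continuous_intros
      continuous_on_compose2[OF assms(1)] continuous_on_compose2[OF assms(2)])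
  ultimately show ?thesis by simp
qed

lemma smallo_of_tendsto_0:
  fixes u r :: "nat \<Rightarrow> real"
  assumes "r \<in> o(u)" "u \<longlonglongrightarrow> 0"
  shows "r \<longlonglongrightarrow> 0"
proof -
  have "u \<in> o(\<lambda>_. 1)" using assms(2) by (intro smalloI_tendsto) auto
  with assms(1) have "r \<in> o(\<lambda>_. 1)" by (rule landau_o.small_trans)
  from smalloD_tendsto[OF this] show ?thesis by simp
qed

text \<open>\<open>smallo_sum\<close> asks for an identity at every \<open>n\<close>; the finitely
  many exceptions are absorbed by taking \<open>r - q\<close> as the first remainder.\<close>

lemma smallo_sumI:
  assumes "p \<in> o(u)" "q \<in> o(v)" "\<forall>\<^sub>F n in sequentially. r n = p n + q n"
  shows "r \<in> smallo_sum u v"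
proof -
  have "\<forall>\<^sub>F n in sequentially. r n - q n = p n"
    using assms(3) by eventually_elim simp
  then have "(\<lambda>n. r n - q n) \<in> o(u)"
    using assms(1) by (subst landau_o.small.in_cong)
  moreover have "\<forall>n. r n = (r n - q n) + q n" by simp
  ultimately show ?thesis
    unfolding smallo_sum_def using assms(2)
    by (intro CollectI bexI[of _ "\<lambda>n. r n - q n"] bexI[of _ q])
qed

theorem theorem2:
  fixes M :: "'a measure"
    and \<Theta> :: "nat \<Rightarrow> 'a \<Rightarrow> real"
    and f :: "real \<Rightarrow> real"
    and L :: "real \<Rightarrow> real \<Rightarrow> real"
    and \<rho> :: "nat \<Rightarrow> real"
    and s :: nat
  assumes s: "even s"
    and M: "prob_space M"
    and f: "circular_density f"
    and indep: "prob_space.indep_vars M (\<lambda>_. borel) \<Theta> {1..}"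
    and distr: "\<And>i. i \<ge> 1 \<Longrightarrow>
      distributed M lborel (\<Theta> i) (\<lambda>x. ennreal (f x * indicator {-pi..<pi} x))"
    and L: "circular_kernel_family L"
    and \<rho>: "\<And>n. \<rho> n \<in> {0..<1}"
    and A1: "times_differentiable (s + 2) f"
      "continuous_on UNIV ((deriv ^^ (s + 2)) f)"
      "circ_square_integrable ((deriv ^^ (s + 2)) f)"
    and A2: "\<And>r. r \<in> {0..<1} \<Longrightarrow>
      bounded (range (L r)) \<and> circular_density (L r) \<and> symmetric_about_zero (L r) \<and>
      circ_unimodal (L r) \<and> times_differentiable s (L r) \<and>
      circ_square_integrable ((deriv ^^ s) (L r))"
    and A3: "(\<lambda>n. h_kernel L (\<rho> n)) \<longlonglongrightarrow> 0"
      "filterlim (\<lambda>n. R_kernel L s 2 (\<rho> n)) at_top sequentially"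
      "(\<lambda>n. R_kernel L s 2 (\<rho> n) / real n) \<longlonglongrightarrow> 0"
    and A4: "filterlim (\<lambda>n. \<bar>R_kernel L s 1 (\<rho> n)\<bar>) at_top sequentially"
      "(\<lambda>n. R_kernel L s 1 (\<rho> n) / real n) \<longlonglongrightarrow> 0"
    and E1: "(\<lambda>n. LINT x:{-pi..<pi}|lborel. x ^ 4 * L (\<rho> n) x) \<in> o(\<lambda>n. h_kernel L (\<rho> n))"
    and E2: "(\<lambda>n. LINT x:{-pi..<pi}|lborel. x\<^sup>2 * ((deriv ^^ s) (L (\<rho> n)) x)\<^sup>2)
      \<in> o(\<lambda>n. R_kernel L s 2 (\<rho> n))"
  shows "has_AMSE M (\<lambda>n. psi_hat L s (\<rho> n) \<Theta> n) (psi f s)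
    (\<lambda>n. R_kernel L s 1 (\<rho> n) / real n + h_kernel L (\<rho> n) * psi f (s + 2) / 2)
    (smallo_sum (\<lambda>n. R_kernel L s 1 (\<rho> n) / real n) (\<lambda>n. h_kernel L (\<rho> n)))
    (\<lambda>n. 2 * psi f 0 * R_kernel L s 2 (\<rho> n) / (real n)\<^sup>2
       + 4 / real n * ((LINT x:{-pi..<pi}|lborel. ((deriv ^^ s) f x)\<^sup>2 * f x) - (psi f s)\<^sup>2))
    (smallo_sum (\<lambda>n. R_kernel L s 2 (\<rho> n) / (real n)\<^sup>2) (\<lambda>n. 1 / real n))
    (\<lambda>n. (R_kernel L s 1 (\<rho> n) / real n + h_kernel L (\<rho> n) * psi f (s + 2) / 2)\<^sup>2
       + 2 * psi f 0 * R_kernel L s 2 (\<rho> n) / (real n)\<^sup>2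
       + 4 / real n * ((LINT x:{-pi..<pi}|lborel. ((deriv ^^ s) f x)\<^sup>2 * f x) - (psi f s)\<^sup>2))"
proof -
  let ?\<mu> = "density lborel (\<lambda>x. ennreal (f x * indicator {-pi..<pi} x))"
  define G where "G n = (deriv ^^ s) (L (\<rho> n))" for n
  define h where "h n = h_kernel L (\<rho> n)" for n
  define R where "R n = R_kernel L s 2 (\<rho> n)" for n
  define R1 where "R1 n = R_kernel L s 1 (\<rho> n)" for n
  define m where "m n = cint (\<lambda>x. x ^ 4 * L (\<rho> n) x)" for n
  define m' where "m' n = cint (\<lambda>x. x\<^sup>2 * (G n x)\<^sup>2)" for n
  define p where "p = (deriv ^^ s) f"
  define p2 where "p2 = (deriv ^^ (s + 2)) f"
  define V where "V = cint (\<lambda>x. (p x)\<^sup>2 * f x) - (psi f s)\<^sup>2"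

  \<comment> \<open>The density and its derivatives\<close>
  have fper: "periodic_2pi f" and f_nonneg: "0 \<le> f x" and f_int: "cint f = 1" for x
    using f by (auto simp: circular_density_def)
  have cf: "continuous_on UNIV f" using times_differentiable_continuous[OF A1(1), of 0] by simp
  have cp: "continuous_on UNIV p" unfolding p_def by (rule times_differentiable_continuous[OF A1(1)]) simp
  have cp2: "continuous_on UNIV p2" unfolding p2_def by (rule A1(2))
  have pper: "periodic_2pi p" "periodic_2pi p2"
    unfolding p_def p2_def by (rule times_differentiable_periodic[OF A1(1) fper]; simp)+
  have Dp: "(p has_real_derivative (deriv ^^ Suc s) f x) (at x)"
    "((deriv ^^ Suc s) f has_real_derivative p2 x) (at x)" for x
    using times_differentiableD[OF A1(1), of s x] times_differentiableD[OF A1(1), of "Suc s" x]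
    by (simp_all add: p_def p2_def)
  obtain P where P: "P > 0" "\<And>x. \<bar>p x\<bar> \<le> P" using continuous_periodic_bounded[OF cp pper(1)] by blast
  obtain P2 where P2: "P2 > 0" "\<And>x. \<bar>p2 x\<bar> \<le> P2" using continuous_periodic_bounded[OF cp2 pper(2)] by blast

  \<comment> \<open>The kernels along the sequence of smoothing parameters\<close>
  have td: "times_differentiable s (L (\<rho> n))" for n using A2[OF \<rho>] by blast
  have K: "continuous_on UNIV (L (\<rho> n))" "0 \<le> L (\<rho> n) u" "L (\<rho> n) (- u) = L (\<rho> n) u" "cint (L (\<rho> n)) = 1"
    "periodic_2pi (L (\<rho> n))" for n u
    using kernel_continuous[OF L \<rho>] A2[OF \<rho>[of n]]
    by (auto simp: circular_density_def symmetric_about_zero_def)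
  have G: "continuous_on UNIV (G n)" "periodic_2pi (G n)" "G n (- u) = G n u" for n u
    unfolding G_def using kernel_deriv_continuous[OF L \<rho> s td] kernel_deriv_even[OF L \<rho> s td]
      times_differentiable_periodic[OF td K(5)] by auto
  have h_eq: "h n = cint (\<lambda>x. x\<^sup>2 * L (\<rho> n) x)" and R_eq: "R n = cint (\<lambda>x. (G n x)\<^sup>2)" and R1_eq: "R1 n = G n 0" for n
    unfolding h_def R_def R1_def G_def
    by (rule h_kernel_eq[OF L \<rho>] R_kernel_2_eq[OF L \<rho> s td] R_kernel_1_eq[OF L \<rho> s td])+
  have h_nonneg: "0 \<le> h n" and R_nonneg: "0 \<le> R n" for n
    unfolding h_eq R_eq using K(2) by (auto intro: cint_nonneg)
  have lim: "h \<longlonglongrightarrow> 0" "filterlim R at_top sequentially" "filterlim (\<lambda>n. \<bar>R1 n\<bar>) at_top sequentially"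
    using A3 A4 by (simp_all add: h_def[abs_def] R_def[abs_def] R1_def)
  have mo: "m \<in> o(h)" "m' \<in> o(R)"
    using E1 E2 by (simp_all add: m_def[abs_def] m'_def[abs_def] h_def[abs_def] R_def[abs_def] G_def)

  define g where "g n y = cint (\<lambda>u. G n u * f (y + u))" for n y
  define c where "c n y = cint (\<lambda>u. (G n u)\<^sup>2 * f (y + u))" for n y
  define e where "e n = cint (\<lambda>y. f y * g n y)" for n
  define q where "q n = cint (\<lambda>y. f y * c n y)" for n
  define v where "v n = cint (\<lambda>y. f y * (g n y)\<^sup>2) - (e n)\<^sup>2" for n
  have cg: "continuous_on UNIV (g n)" for n
    unfolding g_def[abs_def] by (intro local_average_continuous G cf)
  have cc: "continuous_on UNIV (c n)" for n
    unfolding c_def[abs_def] by (intro local_average_continuous continuous_intros G cf)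

  \<comment> \<open>Evenness of \<open>s\<close> removes the sign, and \<open>g n\<close> becomes an
    average of \<open>p\<close> against a probability density.\<close>
  have g_eq: "g n y = cint (\<lambda>u. L (\<rho> n) u * p (y + u))" for n y
  proof -
    have "times_differentiable s f" using A1(1) by (simp add: times_differentiable_def)
    from cint_derivs_shift[OF td G(1)[unfolded G_def] K(5) this cp[unfolded p_def] fper order.refl]
    show ?thesis using s by (simp add: g_def G_def p_def)
  qed
  \<comment> \<open>\<open>C\<close> is independent of \<open>n\<close> and \<open>y\<close>: the
    modulus of \<open>p2\<close> is uniform in the base point, and the kernel enters the error
    through \<open>h\<close> and \<open>m\<close> only.\<close>
  have g_approx: "\<exists>C\<ge>0. \<forall>n y. \<bar>g n y - (p y + h n / 2 * p2 y)\<bar> \<le> \<epsilon> * h n + C * m n" if \<epsilon>: "\<epsilon> > 0" for \<epsilon>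
  proof -
    obtain C where C: "C \<ge> 0" "\<And>x u. \<bar>p2 (x + u) - p2 x\<bar> \<le> \<epsilon> + C * u\<^sup>2"
      using periodic_modulus[OF cp2 pper(2) \<epsilon>] by blast
    show ?thesis
      unfolding g_eq h_eq m_def
      using C local_average_second_order[OF K(1-4) Dp C(1) C(2)] by blast
  qed
  have c_approx: "\<exists>C\<ge>0. \<forall>n y. \<bar>c n y - f y * R n\<bar> \<le> \<epsilon> * R n + C * m' n" if \<epsilon>: "\<epsilon> > 0" for \<epsilon>
  proof -
    obtain C where C: "C \<ge> 0" "\<And>x u. \<bar>f (x + u) - f x\<bar> \<le> \<epsilon> + C * u\<^sup>2"
      using periodic_modulus[OF cf fper \<epsilon>] by blast
    have "\<bar>c n y - f y * R n\<bar> \<le> \<epsilon> * R n + C * m' n" for n y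
      unfolding c_def R_eq m'_def
      by (rule local_average) (auto intro!: continuous_intros G cf C)
    then show ?thesis using C(1) by blast
  qed

  \<comment> \<open>Averaged against \<open>f\<close>, the two leading terms of \<open>g n\<close>
    become \<open>psi f s\<close> and \<open>h n / 2 * psi f (s + 2)\<close>, and the uniform error
    bound is preserved.\<close>
  have e_o: "(\<lambda>n. e n - (psi f s + h n / 2 * psi f (s + 2))) \<in> o(h)"
  proof (rule smallo_of_eps_bound[OF _ h_nonneg mo(1)])
    fix \<epsilon> :: real assume "\<epsilon> > 0"
    then obtain C where C: "\<And>n y. \<bar>g n y - (p y + h n / 2 * p2 y)\<bar> \<le> \<epsilon> * h n + C * m n"
      using g_approx by blast
    have "cint (\<lambda>y. f y * (p y + h n / 2 * p2 y)) = psi f s + h n / 2 * psi f (s + 2)" for n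
    proof -
      have "cint (\<lambda>y. f y * (p y + h n / 2 * p2 y)) = cint (\<lambda>y. p y * f y + h n / 2 * (p2 y * f y))"
        by (simp add: algebra_simps)
      also have "\<dots> = cint (\<lambda>y. p y * f y) + cint (\<lambda>y. h n / 2 * (p2 y * f y))"
        by (intro cint_add continuous_intros cp cf cp2)
      finally show ?thesis by (simp only: set_integral_mult_right psi_def p_def p2_def)
    qed
    moreover have "\<bar>e n - cint (\<lambda>y. f y * (p y + h n / 2 * p2 y))\<bar> \<le> \<epsilon> * h n + C * m n" for n
      unfolding e_def using C by (intro cint_density_average_le f cf continuous_intros cg cp cp2)
    ultimately show "\<exists>C. \<forall>n. \<bar>e n - (psi f s + h n / 2 * psi f (s + 2))\<bar> \<le> \<epsilon> * h n + C * m n"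
      by auto
  qed
  have q_o: "(\<lambda>n. q n - psi f 0 * R n) \<in> o(R)"
  proof (rule smallo_of_eps_bound[OF _ R_nonneg mo(2)])
    fix \<epsilon> :: real assume "\<epsilon> > 0"
    then obtain C where C: "\<And>n y. \<bar>c n y - f y * R n\<bar> \<le> \<epsilon> * R n + C * m' n"
      using c_approx by blast
    \<comment> \<open>\<open>psi f 0\<close> is the integral of \<open>f\<^sup>2\<close>, that is,
      the mean of \<open>f\<close> under its own law.\<close>
    have "cint (\<lambda>y. f y * (f y * R n)) = psi f 0 * R n" for n
      by (simp add: psi_def mult.assoc[symmetric])
    moreover have "\<bar>q n - cint (\<lambda>y. f y * (f y * R n))\<bar> \<le> \<epsilon> * R n + C * m' n" for n
      unfolding q_def using C by (intro cint_density_average_le f cf continuous_intros cc)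
    ultimately show "\<exists>C. \<forall>n. \<bar>q n - psi f 0 * R n\<bar> \<le> \<epsilon> * R n + C * m' n"
      by auto
  qed
  have e_lim: "e \<longlonglongrightarrow> psi f s"
  proof -
    have "(\<lambda>n. (e n - (psi f s + h n / 2 * psi f (s + 2))) + (psi f s + h n / 2 * psi f (s + 2)))
        \<longlonglongrightarrow> 0 + (psi f s + 0 / 2 * psi f (s + 2))"
      by (intro tendsto_intros smallo_of_tendsto_0[OF e_o] lim) simp
    then show ?thesis by simp
  qed
  have v_lim: "v \<longlonglongrightarrow> V"
  proof -
    \<comment> \<open>A fixed \<open>\<epsilon> = 1\<close> suffices for convergence, since
      \<open>h\<close> and \<open>m\<close> both tend to 0.\<close>
    obtain C where C: "C \<ge> 0" "\<And>n y. \<bar>g n y - (p y + h n / 2 * p2 y)\<bar> \<le> 1 * h n + C * m n"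
      using g_approx[of 1] by auto
    define d where "d n = h n / 2 * P2 + 1 * h n + C * m n" for n
    have gd: "\<bar>g n y - p y\<bar> \<le> d n" for n y
    proof -
      have "\<bar>h n / 2 * p2 y\<bar> \<le> h n / 2 * P2"
        unfolding abs_mult using h_nonneg[of n] P2 by (intro mult_mono) auto
      then show ?thesis using C(2)[of n y] unfolding d_def by linarith
    qed
    have "d \<longlonglongrightarrow> 0 / 2 * P2 + 1 * 0 + C * 0"
      unfolding d_def[abs_def] by (intro tendsto_intros lim smallo_of_tendsto_0[OF mo(1) lim(1)]) simp
    then have d0: "d \<longlonglongrightarrow> 0" by simp
    \<comment> \<open>Factoring the difference of squares and using \<open>\<bar>g n y + p y\<bar>
      \<le> \<bar>g n y - p y\<bar> + 2 * \<bar>p y\<bar>\<close> carries uniform convergence over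
      to the squares.\<close>
    have sq: "\<bar>(g n y)\<^sup>2 - (p y)\<^sup>2\<bar> \<le> d n * (d n + 2 * P)" for n y
    proof -
      have "\<bar>g n y + p y\<bar> \<le> d n + 2 * P" using gd[of n y] P(2)[of y] by linarith
      then have "\<bar>g n y - p y\<bar> * \<bar>g n y + p y\<bar> \<le> d n * (d n + 2 * P)"
        using gd[of n y] by (intro mult_mono) auto
      then show ?thesis by (simp add: abs_mult[symmetric] power2_eq_square algebra_simps)
    qed
    have le: "\<bar>cint (\<lambda>y. f y * (g n y)\<^sup>2) - cint (\<lambda>y. f y * (p y)\<^sup>2)\<bar> \<le> d n * (d n + 2 * P)" for n
      using sq by (intro cint_density_average_le f cf continuous_intros cg cp)
    have lim0: "(\<lambda>n. d n * (d n + 2 * P)) \<longlonglongrightarrow> 0"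
      using tendsto_mult[OF d0 tendsto_add[OF d0 tendsto_const[of "2 * P"]]] by simp
    have "(\<lambda>n. cint (\<lambda>y. f y * (g n y)\<^sup>2) - cint (\<lambda>y. f y * (p y)\<^sup>2)) \<longlonglongrightarrow> 0"
      by (rule Lim_null_comparison[OF always_eventually lim0]) (simp only: real_norm_def le simp_thms)
    then have "(\<lambda>n. cint (\<lambda>y. f y * (g n y)\<^sup>2)) \<longlonglongrightarrow> cint (\<lambda>y. f y * (p y)\<^sup>2)"
      by (simp add: LIM_zero_iff)
    then show ?thesis
      unfolding v_def[abs_def] V_def
      by (intro tendsto_intros e_lim) (simp add: mult.commute)
  qed

  \<comment> \<open>Bias and variance of the estimator\<close>
  have iid: "iid_sample M \<Theta> ?\<mu>"
  proof -
    interpret prob_space M by (rule M)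
    show ?thesis
    proof
      show "indep_vars (\<lambda>_. borel) \<Theta> {1..}" by (rule indep)
      show "distr M borel (\<Theta> i) = ?\<mu>" if "i \<ge> 1" for i
      proof -
        have "distr M borel (\<Theta> i) = distr M lborel (\<Theta> i)" by (rule distr_cong) auto
        then show ?thesis using distr[OF that] by (simp add: distributed_def)
      qed
    qed
  qed
  note moments = psi_hat_moments[where L = L and s = s, OF f cf iid G(1,2,3)[unfolded G_def],
      folded G_def, folded g_def c_def, folded e_def q_def, folded v_def]
  have ev1: "\<forall>\<^sub>F n in sequentially. n > 0" by (rule eventually_gt_at_top)
  have inv: "(\<lambda>n. 1 / real n) \<longlonglongrightarrow> 0" by (rule lim_1_over_n)
  \<comment> \<open>Eventual nonvanishing of the comparison sequences allows little-o to be read off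
    from a quotient tending to 0.\<close>
  have R1_nz: "\<forall>\<^sub>F n in sequentially. R1 n \<noteq> 0"
    using filterlim_at_top_dense[THEN iffD1, OF lim(3), rule_format, of 0] by eventually_elim simp
  have R_nz: "\<forall>\<^sub>F n in sequentially. R n > 0"
    using filterlim_at_top_dense[THEN iffD1, OF lim(2)] by blast

  have bias: "(\<lambda>n. prob_space.expectation M (psi_hat L s (\<rho> n) \<Theta> n) - psi f s - (R1 n / real n + h n * psi f (s + 2) / 2))
      \<in> smallo_sum (\<lambda>n. R1 n / real n) h"
  proof (rule smallo_sumI[OF _ e_o])
    \<comment> \<open>The first remainder is \<open>- e n / real n\<close>, the deficit of
      \<open>n (n - 1)\<close> pairs against the divisor \<open>n^2\<close>.\<close>
    have "filterlim R1 at_infinity sequentially"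
      using lim(3) by (simp add: filterlim_at_infinity_conv_norm_at_top)
    then have "(\<lambda>n. - e n / R1 n) \<longlonglongrightarrow> 0"
      by (intro tendsto_divide_0[OF tendsto_minus[OF e_lim]])
    then have "(\<lambda>n. (- e n / real n) / (R1 n / real n)) \<longlonglongrightarrow> 0"
      by (rule Lim_transform_eventually) (use ev1 in \<open>eventually_elim, simp\<close>)
    then show "(\<lambda>n. - e n / real n) \<in> o(\<lambda>n. R1 n / real n)"
      by (rule smalloI_tendsto) (use R1_nz ev1 in \<open>eventually_elim, simp\<close>)
    show "\<forall>\<^sub>F n in sequentially. prob_space.expectation M (psi_hat L s (\<rho> n) \<Theta> n) - psi f s
        - (R1 n / real n + h n * psi f (s + 2) / 2) = - e n / real n + (e n - (psi f s + h n / 2 * psi f (s + 2)))"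
      using ev1 by eventually_elim (simp add: moments(3) R1_eq field_simps power2_eq_square)
  qed
  have var: "(\<lambda>n. prob_space.variance M (psi_hat L s (\<rho> n) \<Theta> n) - (2 * psi f 0 * R n / (real n)\<^sup>2 + 4 / real n * V))
      \<in> smallo_sum (\<lambda>n. R n / (real n)\<^sup>2) (\<lambda>n. 1 / real n)"
  proof (rule smallo_sumI)
    \<comment> \<open>The two summands of the exact variance, each minus its leading term:
      \<open>?p\<close> from the degenerate part \<open>H\<close>, \<open>?q\<close> from the
      projection \<open>w\<close>.\<close>
    let ?p = "\<lambda>n. 2 * (1 - 1 / real n) * (q n - (e n)\<^sup>2 - 2 * v n) / (real n)\<^sup>2 - 2 * psi f 0 * R n / (real n)\<^sup>2"
    let ?q = "\<lambda>n. 4 * (1 - 1 / real n)\<^sup>2 * v n / real n - 4 / real n * V"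
    have "filterlim R at_infinity sequentially"
      by (rule filterlim_at_top_imp_at_infinity[OF lim(2)])
    then have "(\<lambda>n. ((e n)\<^sup>2 + 2 * v n) / R n) \<longlonglongrightarrow> 0"
      by (intro tendsto_divide_0[OF tendsto_add[OF tendsto_power[OF e_lim] tendsto_mult[OF tendsto_const v_lim]]])
    \<comment> \<open>This is \<open>?p\<close> divided by \<open>R n / (real n)\<^sup>2\<close>,
      arranged so that each piece has a limit: \<open>q n / R n\<close> tends to
      \<open>psi f 0\<close>, and the convergent \<open>(e n)\<^sup>2 + 2 * v n\<close> is lost
      against \<open>R n\<close>.\<close>
    then have "(\<lambda>n. 2 * (1 - 1 / real n) * ((q n - psi f 0 * R n) / R n + psi f 0 - ((e n)\<^sup>2 + 2 * v n) / R n) - 2 * psi f 0)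
        \<longlonglongrightarrow> 2 * (1 - 0) * (0 + psi f 0 - 0) - 2 * psi f 0"
      by (intro tendsto_intros inv smalloD_tendsto[OF q_o])
    then have "(\<lambda>n. 2 * (1 - 1 / real n) * ((q n - psi f 0 * R n) / R n + psi f 0 - ((e n)\<^sup>2 + 2 * v n) / R n) - 2 * psi f 0)
        \<longlonglongrightarrow> 0"
      by simp
    then have "(\<lambda>n. ?p n / (R n / (real n)\<^sup>2)) \<longlonglongrightarrow> 0"
      by (rule Lim_transform_eventually) (use ev1 R_nz in \<open>eventually_elim, simp add: field_simps\<close>)
    then show "?p \<in> o(\<lambda>n. R n / (real n)\<^sup>2)"
      by (rule smalloI_tendsto) (use R_nz ev1 in \<open>eventually_elim, simp\<close>)
    have "(\<lambda>n. 4 * (1 - 1 / real n)\<^sup>2 * v n - 4 * V) \<longlonglongrightarrow> 4 * (1 - 0)\<^sup>2 * V - 4 * V"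
      by (intro tendsto_intros inv v_lim)
    then have "(\<lambda>n. 4 * (1 - 1 / real n)\<^sup>2 * v n - 4 * V) \<longlonglongrightarrow> 0" by simp
    then have "(\<lambda>n. ?q n / (1 / real n)) \<longlonglongrightarrow> 0"
      by (rule Lim_transform_eventually) (use ev1 in \<open>eventually_elim, simp add: field_simps\<close>)
    then show "?q \<in> o(\<lambda>n. 1 / real n)"
      by (rule smalloI_tendsto) (use ev1 in \<open>eventually_elim, simp\<close>)
    show "\<forall>\<^sub>F n in sequentially. prob_space.variance M (psi_hat L s (\<rho> n) \<Theta> n)
        - (2 * psi f 0 * R n / (real n)\<^sup>2 + 4 / real n * V) = ?p n + ?q n"
      using ev1
    proof eventually_elim
      case (elim n)
      have "(2 * x * (x - 1) * a + 4 * x * (x - 1)\<^sup>2 * b) / x ^ 4 =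
          2 * (1 - 1 / x) * a / x\<^sup>2 + 4 * (1 - 1 / x)\<^sup>2 * b / x" if "x > 0" for x a b :: real
        using that by (simp add: field_simps power2_eq_square power4_eq_xxxx)
      then show ?case using elim by (simp add: moments(4))
    qed
  qed
  show ?thesis
    unfolding has_AMSE_def
    using bias var moments(1,2)
    by (simp add: R1_def[abs_def] R_def[abs_def] h_def[abs_def] V_def p_def add.assoc)
qed

end
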